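(* Let $M$ be Hrushovski's countable non-collapsed structure for a (not necessarily symmetric) ternary relation $R$ all of whose tuples consist of distinct elements, and let $M_\sim=(M;R_\sim)$ be its reduct to the symmetrization $R_\sim(x_1,x_2,x_3):=\bigvee_{\sigma\in S_3}R(x_{\sigma(1)},x_{\sigma(2)},x_{\sigma(3)})$. Then the geometry of $M$ is isomorphic to the geometry of $M_\sim$.
   Context: The structure $M$. Structures are sets with a ternary relation $R$ holding only of triples of pairwise distinct elements. For finite $A$, $d_0(A)=|A|-|R_A|$ where $R_A\subseteq A^3$ is the set of ordered triples in the relation. For finite $A\subseteq N$, $A\leqslant N$ means $d_0(B)\ge d_0(A)$ for all finite $B$ with $A\subseteq B\subseteq N$. $\mathcal{C}$ is the class of finite structures $A$ with $\emptyset\leqslant A$. $M$ is the unique (up to isomorphism) countable structure all of whose finite substructures lie in $\mathcal{C}$ and such that whenever $A\leqslant M$ is finite and $A\leqslant B\in\mathcal{C}$ there is an embedding of $B$ into $M$ over $A$ with strong image. Geometries. For finite $A\subseteq M$ put $d(A)=\min\{d_0(B):A\subseteq B\subseteq M,\ B\text{ finite}\}$. For finite $A\subseteq M_\sim$ put $d_0^\sim(A)=|A|-r_\sim(A)$, where $r_\sim(A)$ is the number of three-element subsets $\{a,b,c\}\subseteq A$ with $R_\sim(a,b,c)$, and $d^\sim(A)=\min\{d_0^\sim(B):A\subseteq B\subseteq M_\sim,\ B\text{ finite}\}$. The functions $d$ and $d^\sim$ are the dimension functions of pre-geometries on $M$ and $M_\sim$: $a$ is in the closure of $X$ iff for some finite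 $X_0\subseteq X$ the sets $X_0\cup\{a\}$ and $X_0$ have the same dimension. The geometry of the structure is the geometry associated with this pre-geometry, obtained by deleting the closure of $\emptyset$ and identifying two points when they have the same closure. An isomorphism of geometries is a bijection preserving closure. *)

theory Defs
  imports Main "HOL-Library.Countable_Set"
begin

text \<open>A structure is a carrier set together with a set of ordered triples; the structure induced on a
  subset keeps the triples lying inside that subset.\<close>

definition is_structure :: "'a set \<Rightarrow> ('a \<times> 'a \<times> 'a) set \<Rightarrow> bool" where
  "is_structure N R \<longleftrightarrow>
     R \<subseteq> N \<times> N \<times> N \<and> (\<forall>a b c. (a, b, c) \<in> R \<longrightarrow> a \<noteq> b \<and> a \<noteq> c \<and> b \<noteq> c)"

definition induced :: "('a \<times> 'a \<times> 'a) set \<Rightarrow> 'a set \<Rightarrow> ('a \<times> 'a \<times> 'a) set" where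
  "induced R A = R \<inter> (A \<times> A \<times> A)"

definition d0 :: "('a \<times> 'a \<times> 'a) set \<Rightarrow> 'a set \<Rightarrow> int" where
  "d0 R A = int (card A) - int (card (induced R A))"

definition strong :: "'a set \<Rightarrow> 'a set \<Rightarrow> ('a \<times> 'a \<times> 'a) set \<Rightarrow> bool" where
  "strong A N R \<longleftrightarrow> finite A \<and> A \<subseteq> N \<and>
     (\<forall>B. finite B \<and> A \<subseteq> B \<and> B \<subseteq> N \<longrightarrow> d0 R A \<le> d0 R B)"

definition in_class_C :: "'a set \<Rightarrow> ('a \<times> 'a \<times> 'a) set \<Rightarrow> bool" where
  "in_class_C A R \<longleftrightarrow> finite A \<and> is_structure A R \<and> strong {} A R"

definition embedding ::
  "('a \<Rightarrow> 'b) \<Rightarrow> 'a set \<Rightarrow> ('a \<times> 'a \<times> 'a) set \<Rightarrow> 'b set \<Rightarrow> ('b \<times> 'b \<times> 'b) set \<Rightarrow> bool" where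
  "embedding f A R B S \<longleftrightarrow> inj_on f A \<and> f ` A \<subseteq> B \<and>
     (\<forall>a\<in>A. \<forall>b\<in>A. \<forall>c\<in>A. (a, b, c) \<in> R \<longleftrightarrow> (f a, f b, f c) \<in> S)"

text \<open>The defining properties of the countable generic structure, which determine it up to
  isomorphism. In the extension property, the extension \<open>B\<close> of \<open>A\<close> lives on natural numbers and
  contains \<open>A\<close> via a strong embedding \<open>f\<close>. Every finite structure has a copy on natural numbers,
  so this covers all finite extensions; requiring \<open>A \<subseteq> B\<close> literally, inside the type \<open>'a\<close>, would
  leave out extensions when \<open>'a\<close> has too few elements.\<close>

definition hrushovski_generic :: "'a set \<Rightarrow> ('a \<times> 'a \<times> 'a) set \<Rightarrow> bool" where
  "hrushovski_generic M R \<longleftrightarrow>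
     countable M \<and> is_structure M R \<and>
     (\<forall>A. finite A \<and> A \<subseteq> M \<longrightarrow> in_class_C A (induced R A)) \<and>
     (\<forall>A (B :: nat set) S f.
        strong A M R \<and> in_class_C B S \<and> embedding f A R B S \<and> strong (f ` A) B S \<longrightarrow>
        (\<exists>g. embedding g B S M R \<and> (\<forall>a\<in>A. g (f a) = a) \<and> strong (g ` B) M R))"

definition symmetrization :: "('a \<times> 'a \<times> 'a) set \<Rightarrow> ('a \<times> 'a \<times> 'a) set" where
  "symmetrization R = {(x, y, z).
     (x, y, z) \<in> R \<or> (x, z, y) \<in> R \<or> (y, x, z) \<in> R \<or>
     (y, z, x) \<in> R \<or> (z, x, y) \<in> R \<or> (z, y, x) \<in> R}"

definition triple_sets :: "('a \<times> 'a \<times> 'a) set \<Rightarrow> 'a set \<Rightarrow> 'a set set" where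
  "triple_sets S A = {T. T \<subseteq> A \<and> card T = 3 \<and> (\<exists>a b c. T = {a, b, c} \<and> (a, b, c) \<in> S)}"

text \<open>The predimension of a symmetric structure counts unordered triples instead of ordered ones.\<close>

definition d0_sym :: "('a \<times> 'a \<times> 'a) set \<Rightarrow> 'a set \<Rightarrow> int" where
  "d0_sym S A = int (card A) - int (card (triple_sets S A))"

definition dimension :: "('a set \<Rightarrow> int) \<Rightarrow> 'a set \<Rightarrow> 'a set \<Rightarrow> int" where
  "dimension \<delta> M A = (LEAST k. \<exists>B. finite B \<and> A \<subseteq> B \<and> B \<subseteq> M \<and> k = \<delta> B)"

definition dim_closure :: "('a set \<Rightarrow> int) \<Rightarrow> 'a set \<Rightarrow> 'a set \<Rightarrow> 'a set" where
  "dim_closure dm M X = {a \<in> M. \<exists>X0. finite X0 \<and> X0 \<subseteq> X \<and> dm (X0 \<union> {a}) = dm X0}"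

text \<open>The geometry associated with a closure operator \<open>cl\<close> on \<open>M\<close>. Its points are the classes of
  \<open>M - cl {}\<close> under equality of closures, and its closure is the one inherited from \<open>cl\<close>: the
  closure of a set of points \<open>P\<close> consists of the classes of the elements of \<open>cl (\<Union>P)\<close> outside
  \<open>cl {}\<close>.\<close>

definition same_closure :: "('a set \<Rightarrow> 'a set) \<Rightarrow> 'a set \<Rightarrow> ('a \<times> 'a) set" where
  "same_closure cl M = {(a, b). a \<in> M - cl {} \<and> b \<in> M - cl {} \<and> cl {a} = cl {b}}"

definition geom_points :: "('a set \<Rightarrow> 'a set) \<Rightarrow> 'a set \<Rightarrow> 'a set set" where
  "geom_points cl M = (M - cl {}) // same_closure cl M"

definition geom_closure :: "('a set \<Rightarrow> 'a set) \<Rightarrow> 'a set \<Rightarrow> 'a set set \<Rightarrow> 'a set set" where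
  "geom_closure cl M P = (cl (\<Union>P) - cl {}) // same_closure cl M"

definition associated_geometry ::
  "('a set \<Rightarrow> 'a set) \<Rightarrow> 'a set \<Rightarrow> 'a set set \<times> ('a set set \<Rightarrow> 'a set set)" where
  "associated_geometry cl M = (geom_points cl M, geom_closure cl M)"

definition geometry_isomorphic ::
  "'p set \<times> ('p set \<Rightarrow> 'p set) \<Rightarrow> 'q set \<times> ('q set \<Rightarrow> 'q set) \<Rightarrow> bool" where
  "geometry_isomorphic G H \<longleftrightarrow>
     (\<exists>h. bij_betw h (fst G) (fst H) \<and> (\<forall>X. X \<subseteq> fst G \<longrightarrow> h ` (snd G X) = snd H (h ` X)))"

definition geometry ::
  "'a set \<Rightarrow> ('a \<times> 'a \<times> 'a) set \<Rightarrow> 'a set set \<times> ('a set set \<Rightarrow> 'a set set)" where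
  "geometry M R = associated_geometry (dim_closure (dimension (d0 R) M) M) M"

definition geometry_sym ::
  "'a set \<Rightarrow> ('a \<times> 'a \<times> 'a) set \<Rightarrow> 'a set set \<times> ('a set set \<Rightarrow> 'a set set)" where
  "geometry_sym M S = associated_geometry (dim_closure (dimension (d0_sym S) M) M) M"

end

theory Submission
  imports Defs
begin

text \<open>
Both geometries come from the same kind of data. A relation assigns to every three-element set \<open>T\<close> a
weight: the number of orderings of \<open>T\<close> in \<open>R\<close> for \<open>M\<close>, and its truncation at \<open>1\<close> for the
symmetrization. The predimension is the number of points minus the total weight. The isomorphism is a
back-and-forth construction between the two weighted hypergraphs, through finite partial bijections
between strong sets that preserve the dimension of every subset, but in general not the relation.

The strong sets of \<open>M\<close> serve on both sides. Passing to the symmetrization does not raise the weight of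
new triples, hence a set that is strong for \<open>R\<close> is strong for the symmetrization. An extension by new
triples of weight \<open>1\<close> is realised in \<open>M\<close> after choosing one ordering for each of them, and the
truncation does not affect such triples. So both weights satisfy the same axioms, collected in
\<open>rich_structure\<close>, and the back-and-forth step may be proved once for two structures of this kind.

The difficulty of that step is multiplicity: a triple of weight up to \<open>3\<close> on the first side
has to be imitated by triples of weight \<open>1\<close> on the second. The remedy is to give each point \<open>x\<close> of a
strong set \<open>B\<close> three parallel companions. The four points \<open>(x, 0), \<dots>, (x, 3)\<close>, with the three triples
through \<open>(x, 0)\<close> as edges, form a cluster in which every nonempty subset has dimension \<open>1\<close>. A triple
\<open>T\<close> of weight \<open>k\<close> can then be replaced by the \<open>k\<close> distinct triples \<open>T \<times> {1}, \<dots>, T \<times> {k}\<close> without a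
change of dimension. Indeed, adding a whole cluster to a set that meets it never
raises the predimension (\<open>saturate\<close>), so only unions of clusters matter for the dimension, and on
these both sides count the same points and the same weights (\<open>predim_blowup\<close>), up to replacing the
old part of the structure by one of equal dimension (\<open>glued_dominated\<close>). This gives the extension step
\<open>partial_iso_extend_domain\<close>. The union of a chain of partial bijections is a bijection of \<open>M\<close> that
carries one dimension function to the other, hence one closure operator to the other, and so induces
an isomorphism of the geometries.
\<close>

section \<open>Weighted hypergraphs and their predimension\<close>

definition triples :: "'a set \<Rightarrow> 'a set set" where
  "triples X = {T. T \<subseteq> X \<and> card T = 3}"

definition mass :: "('a set \<Rightarrow> nat) \<Rightarrow> 'a set \<Rightarrow> nat" where
  "mass w X = (\<Sum>T\<in>triples X. w T)"

definition predim :: "('a set \<Rightarrow> nat) \<Rightarrow> 'a set \<Rightarrow> int" where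
  "predim w X = int (card X) - int (mass w X)"

lemma finite_triples [simp]: "finite X \<Longrightarrow> finite (triples X)"
  unfolding triples_def by simp

lemma triples_mono: "X \<subseteq> Y \<Longrightarrow> triples X \<subseteq> triples Y"
  unfolding triples_def by auto

lemma mass_cong: "(\<And>T. T \<in> triples X \<Longrightarrow> v T = w T) \<Longrightarrow> mass v X = mass w X"
  unfolding mass_def by (rule sum.cong) auto

lemma predim_cong: "(\<And>T. T \<in> triples X \<Longrightarrow> v T = w T) \<Longrightarrow> predim v X = predim w X"
  unfolding predim_def by (simp add: mass_cong[of X v w])

lemma triples_image:
  assumes "inj_on g X"
  shows "triples (g ` X) = (image g) ` triples X"
proof -
  have "T \<in> (image g) ` triples X" if "T \<subseteq> g ` X" "card T = 3" for T
  proof -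
    obtain S where S: "S \<subseteq> X" "T = g ` S" using \<open>T \<subseteq> g ` X\<close> by (auto simp: subset_image_iff)
    then have "card S = 3" using assms that by (metis card_image inj_on_subset)
    then show ?thesis using S by (auto simp: triples_def)
  qed
  moreover have "card (g ` S) = card S" if "S \<subseteq> X" for S
    using assms that by (metis card_image inj_on_subset)
  ultimately show ?thesis unfolding triples_def by auto
qed

lemma mass_image:
  assumes "inj_on g X"
  shows "mass w (g ` X) = mass (\<lambda>T. w (g ` T)) X"
proof -
  have "inj_on (image g) (triples X)"
    using assms by (auto simp: inj_on_def triples_def inj_on_image_eq_iff[OF assms])
  then show ?thesis
    unfolding mass_def triples_image[OF assms] by (simp add: sum.reindex)
qed

lemma predim_image:
  assumes "inj_on g X"
  shows "predim w (g ` X) = predim (\<lambda>T. w (g ` T)) X"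
  using assms by (simp add: predim_def mass_image card_image)

text \<open>Submodularity: a triple inside \<open>X\<close> or \<open>Y\<close> lies inside \<open>X \<union> Y\<close>, and it is counted twice exactly
when it lies inside \<open>X \<inter> Y\<close>.\<close>

lemma predim_submodular:
  assumes "finite X" "finite Y"
  shows "predim w (X \<union> Y) + predim w (X \<inter> Y) \<le> predim w X + predim w Y"
proof -
  have "mass w X + mass w Y
      = (\<Sum>T\<in>triples X \<union> triples Y. w T) + (\<Sum>T\<in>triples X \<inter> triples Y. w T)"
    unfolding mass_def using assms by (simp add: sum.union_inter)
  also have "triples X \<inter> triples Y = triples (X \<inter> Y)" by (auto simp: triples_def)
  also have "(\<Sum>T\<in>triples X \<union> triples Y. w T) \<le> mass w (X \<union> Y)"
    unfolding mass_def using assms by (intro sum_mono2) (auto simp: triples_def)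
  finally have "mass w X + mass w Y \<le> mass w (X \<union> Y) + mass w (X \<inter> Y)"
    by (simp add: mass_def)
  moreover have "card (X \<union> Y) + card (X \<inter> Y) = card X + card Y"
    using card_Un_Int[OF assms] by simp
  ultimately show ?thesis by (simp add: predim_def)
qed

lemma triples_small: "finite X \<Longrightarrow> card X < 3 \<Longrightarrow> triples X = {}"
  unfolding triples_def by (auto dest: card_mono)

lemma triples_self:
  assumes "card X = 3"
  shows "triples X = {X}"
proof -
  have "finite X" using assms by (simp add: card_ge_0_finite)
  then have "T = X" if "T \<subseteq> X" "card T = 3" for T
    using card_subset_eq[of X T] that assms by simp
  then show ?thesis unfolding triples_def using assms by blast
qed

section \<open>Rich structures\<close>

text \<open>\<open>L\<close> is a set of labels for points, \<open>L0\<close> the part already placed in a structure, and \<open>E\<close> a set of new edges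
of weight \<open>1\<close>. The inequality says that \<open>L0\<close> is strong in the extension, whatever the weights inside
\<open>L0\<close> are.\<close>

definition admissible :: "'l set \<Rightarrow> 'l set \<Rightarrow> 'l set set \<Rightarrow> bool" where
  "admissible L0 L E \<longleftrightarrow> E \<subseteq> triples L \<and> (\<forall>T\<in>E. \<not> T \<subseteq> L0) \<and>
     (\<forall>Y. L0 \<subseteq> Y \<and> Y \<subseteq> L \<longrightarrow> card {T \<in> E. T \<subseteq> Y} \<le> card (Y - L0))"

definition realizes ::
  "('a set \<Rightarrow> bool) \<Rightarrow> ('a set \<Rightarrow> nat) \<Rightarrow> 'l set \<Rightarrow> 'l set \<Rightarrow> 'l set set \<Rightarrow> ('l \<Rightarrow> 'a) \<Rightarrow> ('l \<Rightarrow> 'a) \<Rightarrow> bool"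
  where
  "realizes St w L0 L E h g \<longleftrightarrow> inj_on g L \<and> (\<forall>x\<in>L0. g x = h x) \<and> St (g ` L) \<and>
     (\<forall>T\<in>triples L. \<not> T \<subseteq> L0 \<longrightarrow> w (g ` T) = of_bool (T \<in> E))"

text \<open>The predicate \<open>St\<close> need not be all of strongness for \<open>w\<close>: it may single out fewer sets, provided that
they are cofinal and that extensions can be realised by such sets. This freedom lets the
symmetrization use the strong sets of the original structure. Labels are pairs because the extensions
that occur consist of numbered copies of points.\<close>

locale rich_structure =
  fixes N :: "'a set" and St :: "'a set \<Rightarrow> bool" and w :: "'a set \<Rightarrow> nat"
  assumes St_finite: "St A \<Longrightarrow> finite A"
    and St_subset: "St A \<Longrightarrow> A \<subseteq> N"
    and St_le: "St A \<Longrightarrow> finite B \<Longrightarrow> A \<subseteq> B \<Longrightarrow> B \<subseteq> N \<Longrightarrow> predim w A \<le> predim w B"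
    and St_empty: "St {}"
    and St_hull: "finite X \<Longrightarrow> X \<subseteq> N \<Longrightarrow> \<exists>B. St B \<and> X \<subseteq> B"
    and St_extend: "\<And>(L :: ('a \<times> nat) set) L0 E h. finite L \<Longrightarrow> L0 \<subseteq> L \<Longrightarrow> inj_on h L0 \<Longrightarrow>
      St (h ` L0) \<Longrightarrow> admissible L0 L E \<Longrightarrow> \<exists>g. realizes St w L0 L E h g"
begin

lemma predim_nonneg: "finite X \<Longrightarrow> X \<subseteq> N \<Longrightarrow> 0 \<le> predim w X"
  using St_le[OF St_empty, of X] by (simp add: predim_def[of w "{}"] mass_def triples_small)

lemma weight_le_3:
  assumes "T \<in> triples N"
  shows "w T \<le> 3"
proof -
  have T: "card T = 3" "T \<subseteq> N" using assms by (auto simp: triples_def)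
  then have "finite T" by (simp add: card_ge_0_finite)
  then have "0 \<le> predim w T" using T predim_nonneg by blast
  then show ?thesis using T by (simp add: predim_def mass_def triples_self)
qed

lemma
  assumes "finite X" "X \<subseteq> N"
  shows dimension_attained: "\<exists>B. finite B \<and> X \<subseteq> B \<and> B \<subseteq> N \<and> dimension (predim w) N X = predim w B"
    and dimension_le: "\<And>B. finite B \<Longrightarrow> X \<subseteq> B \<Longrightarrow> B \<subseteq> N \<Longrightarrow> dimension (predim w) N X \<le> predim w B"
proof -
  let ?P = "\<lambda>B. finite B \<and> X \<subseteq> B \<and> B \<subseteq> N"
  \<comment> \<open>The integers are not well-ordered; minimisation takes place in \<open>nat\<close>, which is faithful because predimensions are nonnegative.\<close>
  obtain B where B: "?P B" and min: "\<And>C. ?P C \<Longrightarrow> nat (predim w B) \<le> nat (predim w C)"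
    using ex_has_least_nat[of ?P X "\<lambda>B. nat (predim w B)"] assms by auto
  have le: "predim w B \<le> predim w C" if "?P C" for C
    using min[OF that] predim_nonneg[of B] predim_nonneg[of C] B that by auto
  have eq: "dimension (predim w) N X = predim w B"
    unfolding dimension_def by (rule Least_equality) (use B le in auto)
  show "\<exists>B. finite B \<and> X \<subseteq> B \<and> B \<subseteq> N \<and> dimension (predim w) N X = predim w B"
    using B eq by blast
  show "dimension (predim w) N X \<le> predim w C" if "finite C" "X \<subseteq> C" "C \<subseteq> N" for C
    using eq le that by simp
qed

text \<open>By submodularity, intersecting a set with a strong set does not raise the predimension; hence the
dimension of a subset of a strong set can be computed inside that set.\<close>

lemma dimension_attained_in_strong:
  assumes "St A" "X \<subseteq> A"
  shows "\<exists>C. X \<subseteq> C \<and> C \<subseteq> A \<and> dimension (predim w) N X = predim w C"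
proof -
  have A: "finite A" "A \<subseteq> N" using assms St_finite St_subset by auto
  then have X: "finite X" "X \<subseteq> N" using assms finite_subset by auto
  obtain B where B: "finite B" "X \<subseteq> B" "B \<subseteq> N" "dimension (predim w) N X = predim w B"
    using dimension_attained[OF X] by blast
  have "predim w A \<le> predim w (B \<union> A)"
    using St_le[OF assms(1)] A B by simp
  then have "predim w (B \<inter> A) \<le> predim w B"
    using predim_submodular[of B A w] A B by simp
  moreover have "dimension (predim w) N X \<le> predim w (B \<inter> A)"
    using dimension_le[OF X, of "B \<inter> A"] B assms by auto
  ultimately show ?thesis using B assms by (intro exI[of _ "B \<inter> A"]) auto
qed

end

section \<open>Clusters of parallel points\<close>

abbreviation levels :: "nat set" where "levels \<equiv> {..<4}"

definition cluster :: "'a \<Rightarrow> ('a \<times> nat) set" where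
  "cluster x = {x} \<times> levels"

text \<open>The three triples of the cluster of \<open>x\<close> that contain \<open>(x, 0)\<close>.\<close>

definition links :: "'a \<Rightarrow> ('a \<times> nat) set set" where
  "links x = (\<lambda>i. cluster x - {(x, i)}) ` {1, 2, 3}"

text \<open>A triple of weight \<open>c T\<close> becomes \<open>c T\<close> edges on the levels \<open>1, \<dots>, c T\<close>. Level \<open>0\<close> is left out, so that
no copy lies among the old points; \<open>c T \<le> 3\<close> makes four levels enough.\<close>

definition copies :: "'a set \<Rightarrow> ('a set \<Rightarrow> nat) \<Rightarrow> 'a set \<Rightarrow> ('a \<times> nat) set set" where
  "copies A c Z = (\<lambda>(T, i). T \<times> {i}) ` (SIGMA T:{T \<in> triples Z. \<not> T \<subseteq> A}. {1..c T})"

definition blowup_edges :: "'a set \<Rightarrow> ('a set \<Rightarrow> nat) \<Rightarrow> 'a set \<Rightarrow> ('a \<times> nat) set set" where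
  "blowup_edges A c Z = (\<Union>x\<in>Z. links x) \<union> copies A c Z"

text \<open>The old points are \<open>A \<times> {0}\<close>, carrying the weight \<open>u\<close>; all other triples have the weights
prescribed by the edges added over them.\<close>

definition blowup ::
  "'a set \<Rightarrow> ('a set \<Rightarrow> nat) \<Rightarrow> ('a set \<Rightarrow> nat) \<Rightarrow> 'a set \<Rightarrow> ('a \<times> nat) set \<Rightarrow> nat" where
  "blowup A u c B T = (if T \<subseteq> A \<times> {0} then u (fst ` T) else of_bool (T \<in> blowup_edges A c B))"

definition new_mass :: "'a set \<Rightarrow> ('a set \<Rightarrow> nat) \<Rightarrow> 'a set \<Rightarrow> nat" where
  "new_mass A c Z = (\<Sum>T | T \<in> triples Z \<and> \<not> T \<subseteq> A. c T)"

text \<open>The predimension of the structure with weight \<open>u\<close> on triples inside \<open>A\<close> and weight \<open>c\<close> on the other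
triples.\<close>

definition glued :: "'a set \<Rightarrow> ('a set \<Rightarrow> nat) \<Rightarrow> ('a set \<Rightarrow> nat) \<Rightarrow> 'a set \<Rightarrow> int" where
  "glued A u c Z = predim u (Z \<inter> A) + int (card (Z - A)) - int (new_mass A c Z)"

lemma finite_cluster [simp]: "finite (cluster x)" and card_cluster [simp]: "card (cluster x) = 4"
  by (simp_all add: cluster_def)

lemma triples_cluster: "triples (cluster x) = insert (cluster x - {(x, 0)}) (links x)"
proof (intro equalityI subsetI)
  fix T assume "T \<in> triples (cluster x)"
  then have T: "T \<subseteq> cluster x" "card T = 3" by (auto simp: triples_def)
  then have "card (cluster x - T) = 1" by (simp add: card_Diff_subset finite_subset)
  then obtain p where "cluster x - T = {p}" by (auto simp: card_1_singleton_iff)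
  then have p: "p \<in> cluster x" "T = cluster x - {p}" using T by auto
  then obtain i where "p = (x, i)" "i < 4" by (auto simp: cluster_def)
  moreover from \<open>i < 4\<close> have "i = 0 \<or> i = 1 \<or> i = 2 \<or> i = 3" by arith
  ultimately show "T \<in> insert (cluster x - {(x, 0)}) (links x)"
    using p(2) by (auto simp: links_def)
next
  fix T assume "T \<in> insert (cluster x - {(x, 0)}) (links x)"
  then obtain i where "i \<in> {0, 1, 2, 3}" "T = cluster x - {(x, i)}" unfolding links_def by blast
  then show "T \<in> triples (cluster x)"
    by (auto simp: triples_def cluster_def card_Diff_singleton)
qed

lemma card_links: "card (links x) = 3"
proof -
  have "inj_on (\<lambda>i. cluster x - {(x, i)}) {1, 2, 3}"
    by (rule inj_onI) (force simp: cluster_def)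
  then show ?thesis by (simp add: links_def card_image)
qed

lemma fst_link: "T \<in> links x \<Longrightarrow> fst ` T = {x}"
  and link_not_base: "T \<in> links x \<Longrightarrow> \<not> T \<subseteq> A \<times> {0}"
  and link_has_base: "T \<in> links x \<Longrightarrow> (x, 0) \<in> T"
proof -
  assume "T \<in> links x"
  then obtain i where i: "i \<in> {1, 2, 3}" "T = cluster x - {(x, i)}" by (auto simp: links_def)
  show b: "(x, 0) \<in> T" using i by (auto simp: cluster_def)
  have "T \<subseteq> cluster x" using i by blast
  then have "fst ` T \<subseteq> {x}" by (auto simp: cluster_def)
  then show "fst ` T = {x}" using b by force
  have "(x, 1) \<in> T \<or> (x, 2) \<in> T" using i by (auto simp: cluster_def)
  then show "\<not> T \<subseteq> A \<times> {0}" by auto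
qed

lemma copiesE:
  assumes "S \<in> copies A c Z"
  obtains T i where "S = T \<times> {i}" "T \<in> triples Z" "\<not> T \<subseteq> A" "1 \<le> i" "i \<le> c T"
proof -
  obtain T i where "T \<in> {T \<in> triples Z. \<not> T \<subseteq> A}" "i \<in> {1..c T}" "S = T \<times> {i}"
    using assms unfolding copies_def by blast
  then show thesis using that[of T i] by auto
qed

lemma links_triples: "x \<in> Z \<Longrightarrow> links x \<subseteq> triples (Z \<times> levels)"
proof -
  assume "x \<in> Z"
  then have "cluster x \<subseteq> Z \<times> levels" unfolding cluster_def by blast
  then have "triples (cluster x) \<subseteq> triples (Z \<times> levels)" by (rule triples_mono)
  moreover have "links x \<subseteq> triples (cluster x)" unfolding triples_cluster by (rule subset_insertI)
  ultimately show ?thesis by (rule order_trans[rotated])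
qed

lemma copies_triples:
  assumes "\<And>T. T \<in> triples Z \<Longrightarrow> c T \<le> 3"
  shows "copies A c Z \<subseteq> triples (Z \<times> levels)"
proof
  fix S assume "S \<in> copies A c Z"
  then obtain T i where S: "S = T \<times> {i}" "T \<in> triples Z" "\<not> T \<subseteq> A" "1 \<le> i" "i \<le> c T"
    by (rule copiesE)
  then have "i < 4" using assms[of T] by fastforce
  moreover have "T \<subseteq> Z" "card T = 3" using S(2) by (auto simp: triples_def)
  ultimately show "S \<in> triples (Z \<times> levels)"
    unfolding triples_def S(1) using S(4) by (auto simp: card_cartesian_product)
qed

lemma copy_not_base: "S \<in> copies A c Z \<Longrightarrow> \<not> S \<subseteq> A' \<times> {0}"
  by (elim copiesE) (auto simp: triples_def)

text \<open>Every nonempty subset of a cluster has predimension at least \<open>1\<close>, while the whole cluster has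
predimension \<open>1\<close>. By submodularity, adding the cluster to a set that meets it does not raise the
predimension.\<close>

lemma saturate:
  assumes Y: "finite Y" "Y \<subseteq> UNIV \<times> levels"
    and three: "\<And>x. x \<in> fst ` Y \<Longrightarrow> mass v (cluster x) = 3"
    and simple: "\<And>x T. x \<in> fst ` Y \<Longrightarrow> T \<in> triples (cluster x) \<Longrightarrow> v T \<le> 1"
  shows "predim v (fst ` Y \<times> levels) \<le> predim v Y"
proof -
  have one: "1 \<le> predim v S" if "x \<in> fst ` Y" "S \<subseteq> cluster x" "S \<noteq> {}" for x S
  proof -
    have fin: "finite S" by (rule finite_subset[OF that(2) finite_cluster])
    have "card S \<le> 4" using card_mono[OF finite_cluster that(2)] by simp
    moreover have "card S > 0" using that fin by (simp add: card_gt_0_iff)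
    ultimately consider "card S < 3" | "card S = 3" | "card S = 4" by linarith
    then show ?thesis
    proof cases
      case 1
      then show ?thesis using \<open>card S > 0\<close> fin by (simp add: predim_def mass_def triples_small)
    next
      case 2
      then have "v S \<le> 1" using simple that by (auto simp: triples_def)
      then show ?thesis using 2 by (simp add: predim_def mass_def triples_self)
    next
      case 3
      then have "S = cluster x" using that by (simp add: card_subset_eq)
      then show ?thesis using three that 3 by (simp add: predim_def)
    qed
  qed
  have step: "predim v (Y \<union> Z \<times> levels) \<le> predim v Y" if "finite Z" "Z \<subseteq> fst ` Y" for Z
    using that
  proof (induction Z rule: finite_induct)
    case (insert x Z)
    let ?U = "Y \<union> Z \<times> levels"
    have x: "x \<in> fst ` Y" using insert by simp
    have "?U \<inter> cluster x \<noteq> {}" using x Y by (auto simp: cluster_def)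
    then have "1 \<le> predim v (?U \<inter> cluster x)" by (rule one[OF x Int_lower2])
    moreover have "predim v (cluster x) = 1" using three[OF x] by (simp add: predim_def)
    moreover have "predim v (?U \<union> cluster x) + predim v (?U \<inter> cluster x)
        \<le> predim v ?U + predim v (cluster x)"
      using insert Y by (intro predim_submodular) auto
    moreover have "Y \<union> insert x Z \<times> levels = ?U \<union> cluster x" by (auto simp: cluster_def)
    ultimately show ?case using insert by simp
  qed simp
  have "Y \<union> fst ` Y \<times> levels = fst ` Y \<times> levels" using Y by force
  then show ?thesis using step[of "fst ` Y"] Y by simp
qed

text \<open>The triples of positive weight in a union of clusters are old triples, links and copies, and these
three families are disjoint: old triples live on level \<open>0\<close>, links project to a single point and pass
through level \<open>0\<close>, copies avoid level \<open>0\<close>.\<close>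

lemma mass_blowup:
  assumes "finite B" "A \<subseteq> B" "Z \<subseteq> B" and c: "\<And>T. T \<in> triples B \<Longrightarrow> c T \<le> 3"
  shows "mass (blowup A u c B) (Z \<times> levels) = mass u (Z \<inter> A) + 3 * card Z + new_mass A c Z"
proof -
  let ?v = "blowup A u c B"
  let ?base = "triples ((Z \<inter> A) \<times> {0::nat})"
  let ?links = "\<Union>x\<in>Z. links x"
  have finZ: "finite Z" using assms finite_subset by blast
  have base_sub: "?base \<subseteq> triples (Z \<times> levels)"
    by (rule triples_mono) auto
  have links_sub: "?links \<subseteq> triples (Z \<times> levels)"
    by (rule UN_least) (rule links_triples)
  have copies_sub: "copies A c Z \<subseteq> triples (Z \<times> levels)"
    using c triples_mono[OF assms(3)] by (intro copies_triples) auto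
  have copies_not_link: "S \<notin> links x" if "S \<in> copies A c Z'" for S Z' x
    using that link_has_base[of S x] by (elim copiesE) auto
  have vbase: "?v S = u (fst ` S)" if "S \<in> ?base" for S
    using that by (auto simp: blowup_def triples_def)
  have vlinks: "?v S = 1" if "S \<in> ?links" for S
    using that assms link_not_base by (fastforce simp: blowup_def blowup_edges_def)
  have copies_mono: "copies A c Z \<subseteq> copies A c B"
    unfolding copies_def using triples_mono[OF assms(3)] by (intro image_mono Sigma_mono) auto
  have vcopies: "?v S = 1" if "S \<in> copies A c Z" for S
    using that copies_mono copy_not_base[OF that] by (auto simp: blowup_def blowup_edges_def)
  have vzero: "?v S = 0" if "S \<in> triples (Z \<times> levels) - (?base \<union> (?links \<union> copies A c Z))" for S
  proof -
    have S: "S \<subseteq> Z \<times> levels" "card S = 3" using that by (auto simp: triples_def)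
    have "\<not> S \<subseteq> A \<times> {0}"
    proof
      assume "S \<subseteq> A \<times> {0}"
      then have "S \<subseteq> (Z \<inter> A) \<times> {0}" using S by auto
      then show False using that S by (simp add: triples_def)
    qed
    moreover have "S \<notin> links x" for x
    proof
      assume "S \<in> links x"
      then have "x \<in> Z" using link_has_base S by fastforce
      then show False using that \<open>S \<in> links x\<close> by blast
    qed
    moreover have "S \<notin> copies A c B"
    proof
      assume "S \<in> copies A c B"
      then obtain T i where T: "S = T \<times> {i}" "T \<in> triples B" "\<not> T \<subseteq> A" "1 \<le> i" "i \<le> c T"
        by (rule copiesE)
      then have "T \<subseteq> Z" using S by auto
      then have "S \<in> copies A c Z" using T by (auto simp: copies_def triples_def)
      then show False using that by blast
    qed
    ultimately show ?thesis by (auto simp: blowup_def blowup_edges_def)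
  qed
  have fin: "finite (triples (Z \<times> levels))" using finZ by simp
  have "mass ?v (Z \<times> levels) = sum ?v (?base \<union> (?links \<union> copies A c Z))"
    unfolding mass_def
    using base_sub links_sub copies_sub vzero fin by (intro sum.mono_neutral_right) auto
  also have "\<dots> = sum ?v ?base + (sum ?v ?links + sum ?v (copies A c Z))"
  proof -
    have "?base \<inter> (?links \<union> copies A c Z) = {}"
      using link_not_base[of _ _ UNIV] copy_not_base[of _ A c Z UNIV] by (fastforce simp: triples_def)
    moreover have "?links \<inter> copies A c Z = {}" using copies_not_link by auto
    ultimately show ?thesis
      using finite_subset[OF base_sub fin] finite_subset[OF links_sub fin]
        finite_subset[OF copies_sub fin]
      by (simp add: sum.union_disjoint)
  qed
  also have "sum ?v ?base = mass u (Z \<inter> A)"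
  proof -
    have "sum ?v ?base = mass (\<lambda>S. u (fst ` S)) ((Z \<inter> A) \<times> {0::nat})"
      unfolding mass_def using vbase by (intro sum.cong) auto
    also have "\<dots> = mass u (fst ` ((Z \<inter> A) \<times> {0::nat}))"
      by (rule mass_image[symmetric]) (auto simp: inj_on_def)
    finally show ?thesis by simp
  qed
  also have "sum ?v ?links = 3 * card Z"
  proof -
    have "sum ?v ?links = card ?links" using vlinks by simp
    also have "\<dots> = (\<Sum>x\<in>Z. card (links x))"
    proof (rule card_UN_disjoint[OF finZ])
      show "\<forall>x\<in>Z. finite (links x)" by (simp add: links_def)
      have "links x \<inter> links y = {}" if "x \<noteq> y" for x y :: 'a
        using that fst_link by (metis disjoint_iff singleton_inject)
      then show "\<forall>x\<in>Z. \<forall>y\<in>Z. x \<noteq> y \<longrightarrow> links x \<inter> links y = {}" by blast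
    qed
    finally show ?thesis by (simp add: card_links)
  qed
  also have "sum ?v (copies A c Z) = new_mass A c Z"
  proof -
    have inj: "inj_on (\<lambda>(T, i). T \<times> {i}) (SIGMA T:{T \<in> triples Z. \<not> T \<subseteq> A}. {1..c T})"
      by (auto simp: inj_on_def triples_def times_eq_iff)
    have "sum ?v (copies A c Z) = card (copies A c Z)" using vcopies by simp
    also have "\<dots> = new_mass A c Z"
      unfolding copies_def card_image[OF inj] new_mass_def using finZ by (simp add: card_SigmaI)
    finally show ?thesis .
  qed
  finally show ?thesis by simp
qed

lemma mass_split:
  assumes "finite Z"
  shows "mass w Z = mass w (Z \<inter> A) + new_mass A w Z"
proof -
  have "triples Z = triples (Z \<inter> A) \<union> {T \<in> triples Z. \<not> T \<subseteq> A}"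
    by (auto simp: triples_def)
  moreover have "triples (Z \<inter> A) \<inter> {T \<in> triples Z. \<not> T \<subseteq> A} = {}"
    by (auto simp: triples_def)
  ultimately show ?thesis
    unfolding mass_def new_mass_def using assms sum.union_disjoint[of "triples (Z \<inter> A)"]
    by (metis (no_types, lifting) finite_Un finite_triples)
qed

lemma new_mass_mono: "finite Z' \<Longrightarrow> Z \<subseteq> Z' \<Longrightarrow> new_mass A c Z \<le> new_mass A c Z'"
  unfolding new_mass_def using triples_mono[of Z Z'] by (intro sum_mono2) auto

lemma glued_self:
  assumes "finite Z"
  shows "glued A w w Z = predim w Z"
proof -
  have "card Z = card (Z \<inter> A) + card (Z - A)" using assms by (rule card_Int_Diff)
  then show ?thesis using mass_split[OF assms, of w A] by (simp add: glued_def predim_def)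
qed

text \<open>Each of the \<open>|Z|\<close> clusters has four points and three links, so it counts as a single point. Thus
replacing multiple triples by copies is invisible to the predimension of a union of clusters.\<close>

lemma predim_blowup:
  assumes "finite B" "A \<subseteq> B" "Z \<subseteq> B" "\<And>T. T \<in> triples B \<Longrightarrow> c T \<le> 3"
  shows "predim (blowup A u c B) (Z \<times> levels) = glued A u c Z"
proof -
  have "finite Z" using assms finite_subset by blast
  then have "card Z = card (Z \<inter> A) + card (Z - A)" by (rule card_Int_Diff)
  then show ?thesis
    using mass_blowup[of B A Z c u] assms
    by (simp add: predim_def glued_def card_cartesian_product)
qed

lemma blowup_saturate:
  assumes "finite B" "A \<subseteq> B" "Y \<subseteq> B \<times> levels" and c: "\<And>T. T \<in> triples B \<Longrightarrow> c T \<le> 3"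
  shows "predim (blowup A u c B) (fst ` Y \<times> levels) \<le> predim (blowup A u c B) Y"
proof (rule saturate)
  show "finite Y" using assms finite_subset by blast
  show "Y \<subseteq> UNIV \<times> levels" using assms by auto
next
  fix x assume "x \<in> fst ` Y"
  then have x: "x \<in> B" using assms by auto
  have "triples {x} = {}" "triples ({x} \<inter> A) = {}" by (auto intro!: triples_small simp: Int_insert_left)
  then show "mass (blowup A u c B) (cluster x) = 3"
    using mass_blowup[of B A "{x}" c u] assms x
    by (simp add: cluster_def new_mass_def mass_def)
  fix T assume T: "T \<in> triples (cluster x)"
  have "\<not> T \<subseteq> A \<times> {0}"
  proof
    assume "T \<subseteq> A \<times> {0}"
    then have "T \<subseteq> {(x, 0)}" using T by (auto simp: triples_def cluster_def)
    then have "card T \<le> 1" using card_mono[of "{(x, 0)}" T] by simp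
    then show False using T by (simp add: triples_def)
  qed
  then show "blowup A u c B T \<le> 1" by (simp add: blowup_def)
qed

text \<open>After saturation, strongness of the old points in the blowup becomes strongness of \<open>A\<close> in the glued
structure, which is the hypothesis on \<open>new_mass\<close>.\<close>

lemma admissible_blowup:
  assumes B: "finite B" "A \<subseteq> B" and c: "\<And>T. T \<in> triples B \<Longrightarrow> c T \<le> 3"
    and le: "\<And>Z. A \<subseteq> Z \<Longrightarrow> Z \<subseteq> B \<Longrightarrow> new_mass A c Z \<le> card (Z - A)"
  shows "admissible (A \<times> {0}) (B \<times> levels) (blowup_edges A c B)"
  unfolding admissible_def
proof (intro conjI allI impI)
  \<comment> \<open>Weight \<open>0\<close> on the old triples makes the mass of a set equal to the number of edges inside it.\<close>
  let ?E = "blowup_edges A c B" and ?v = "blowup A (\<lambda>_. 0) c B"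
  show E: "?E \<subseteq> triples (B \<times> levels)"
    unfolding blowup_edges_def
    by (intro Un_least UN_least links_triples copies_triples c)
  show new: "\<forall>T\<in>?E. \<not> T \<subseteq> A \<times> {0}"
    unfolding blowup_edges_def by (auto dest: link_not_base copy_not_base)
  fix Y assume Y: "A \<times> {0} \<subseteq> Y \<and> Y \<subseteq> B \<times> levels"
  then have fin: "finite Y" using B finite_subset[of Y "B \<times> levels"] by simp
  let ?Z = "fst ` Y"
  have Z: "A \<subseteq> ?Z" "?Z \<subseteq> B" using Y by force+
  have "mass ?v Y = (\<Sum>T\<in>triples Y. of_bool (T \<in> ?E))"
    unfolding mass_def using new by (intro sum.cong) (auto simp: blowup_def)
  also have "\<dots> = card {T \<in> triples Y. T \<in> ?E}"
    using fin by (simp add: sum.If_cases of_bool_def Int_def)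
  also have "{T \<in> triples Y. T \<in> ?E} = {T \<in> ?E. T \<subseteq> Y}"
    using E by (auto simp: triples_def)
  finally have "int (card Y) - int (card {T \<in> ?E. T \<subseteq> Y}) = predim ?v Y"
    by (simp add: predim_def)
  moreover have "predim ?v (?Z \<times> levels) \<le> predim ?v Y"
    using blowup_saturate[OF B conjunct2[OF Y] c] .
  moreover have "predim ?v (?Z \<times> levels) = glued A (\<lambda>_. 0) c ?Z"
    using predim_blowup[OF B Z(2) c] .
  moreover have "int (card A) \<le> glued A (\<lambda>_. 0) c ?Z"
    using le[OF Z] Z(1) by (simp add: glued_def predim_def mass_def Int_absorb1)
  ultimately have "card A + card {T \<in> ?E. T \<subseteq> Y} \<le> card Y" by linarith
  moreover have "card (Y - A \<times> {0}) = card Y - card A"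
    using Y fin finite_subset[OF _ B(1)] B(2) by (simp add: card_Diff_subset card_cartesian_product)
  ultimately show "card {T \<in> ?E. T \<subseteq> Y} \<le> card (Y - A \<times> {0})" by simp
qed

section \<open>Extending partial isomorphisms\<close>

text \<open>Domination of \<open>\<alpha>\<close> over \<open>\<beta>\<close> says that the dimension function of \<open>\<beta>\<close> inside \<open>A\<close> is at most that of \<open>\<alpha>\<close>.
Domination in both directions therefore means equal dimensions, expressed without taking minima.\<close>

definition dominated :: "'l set \<Rightarrow> ('l set \<Rightarrow> int) \<Rightarrow> ('l set \<Rightarrow> int) \<Rightarrow> bool" where
  "dominated A \<alpha> \<beta> \<longleftrightarrow> (\<forall>X\<subseteq>A. \<exists>Y. X \<subseteq> Y \<and> Y \<subseteq> A \<and> \<beta> Y \<le> \<alpha> X)"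

lemma dominatedD:
  "dominated A \<alpha> \<beta> \<Longrightarrow> X \<subseteq> A \<Longrightarrow> \<exists>Y. X \<subseteq> Y \<and> Y \<subseteq> A \<and> \<beta> Y \<le> \<alpha> X"
  by (simp add: dominated_def)

lemma dominated_cong:
  assumes "\<And>X. X \<subseteq> A \<Longrightarrow> \<alpha> X = \<alpha>' X" "\<And>X. X \<subseteq> A \<Longrightarrow> \<beta> X = \<beta>' X"
  shows "dominated A \<alpha> \<beta> \<longleftrightarrow> dominated A \<alpha>' \<beta>'"
  unfolding dominated_def using assms by metis

lemma dominated_image:
  assumes "dominated A (\<lambda>X. \<alpha> (k ` X)) (\<lambda>X. \<beta> (k ` X))"
  shows "dominated (k ` A) \<alpha> \<beta>"
  unfolding dominated_def
proof (intro allI impI)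
  fix X assume "X \<subseteq> k ` A"
  then obtain X' where X': "X' \<subseteq> A" "X = k ` X'" by (auto simp: subset_image_iff)
  then obtain Y' where "X' \<subseteq> Y'" "Y' \<subseteq> A" "\<beta> (k ` Y') \<le> \<alpha> (k ` X')"
    using dominatedD[OF assms X'(1)] by auto
  then show "\<exists>Y. X \<subseteq> Y \<and> Y \<subseteq> k ` A \<and> \<beta> Y \<le> \<alpha> X"
    using X' by (intro exI[of _ "k ` Y'"]) auto
qed

text \<open>The structure on \<open>A\<close> may be exchanged for another one of no larger dimension: enlarge the trace of
\<open>Z\<close> on \<open>A\<close> to a set \<open>C\<close> of small predimension. This adds no points outside \<open>A\<close>, and the new triples
inside \<open>Z\<close> remain inside \<open>Z \<union> C\<close>.\<close>

lemma glued_dominated: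
  assumes "finite B" "A \<subseteq> B" and dom: "dominated A (predim u) (predim u')"
  shows "dominated B (glued A u c) (glued A u' c)"
  unfolding dominated_def
proof (intro allI impI)
  fix Z assume Z: "Z \<subseteq> B"
  obtain C where C: "Z \<inter> A \<subseteq> C" "C \<subseteq> A" "predim u' C \<le> predim u (Z \<inter> A)"
    using dominatedD[OF dom Int_lower2[of Z A]] by auto
  have "finite (Z \<union> C)" using assms Z C by (meson Un_least finite_subset order_trans)
  then have "new_mass A c Z \<le> new_mass A c (Z \<union> C)" by (rule new_mass_mono) simp
  moreover have "(Z \<union> C) \<inter> A = C" "(Z \<union> C) - A = Z - A" using C by auto
  ultimately have "glued A u' c (Z \<union> C) \<le> glued A u c Z" using C(3) by (simp add: glued_def)
  then show "\<exists>Z'. Z \<subseteq> Z' \<and> Z' \<subseteq> B \<and> glued A u' c Z' \<le> glued A u c Z"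
    using Z C assms by (intro exI[of _ "Z \<union> C"]) auto
qed

lemma blowup_dominated:
  assumes B: "finite B" "A \<subseteq> B" "A' \<subseteq> B"
    and c: "\<And>T. T \<in> triples B \<Longrightarrow> c T \<le> 3" "\<And>T. T \<in> triples B \<Longrightarrow> c' T \<le> 3"
    and dom: "dominated B (glued A u c) (glued A' u' c')"
  shows "dominated (B \<times> levels) (predim (blowup A u c B)) (predim (blowup A' u' c' B))"
  unfolding dominated_def
proof (intro allI impI)
  fix Y assume Y: "Y \<subseteq> B \<times> levels"
  let ?Z = "fst ` Y"
  have Z: "?Z \<subseteq> B" using Y by auto
  then obtain Z' where Z': "?Z \<subseteq> Z'" "Z' \<subseteq> B" "glued A' u' c' Z' \<le> glued A u c ?Z"
    using dominatedD[OF dom Z] by auto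
  have "predim (blowup A' u' c' B) (Z' \<times> levels) \<le> predim (blowup A u c B) (?Z \<times> levels)"
    using predim_blowup[OF B(1,2) Z c(1), where u = u] predim_blowup[OF B(1,3) Z'(2) c(2), where u = u'] Z'(3)
    by simp
  also have "\<dots> \<le> predim (blowup A u c B) Y"
    using blowup_saturate[OF B(1,2) Y c(1)] .
  finally show "\<exists>Y'. Y \<subseteq> Y' \<and> Y' \<subseteq> B \<times> levels \<and>
      predim (blowup A' u' c' B) Y' \<le> predim (blowup A u c B) Y"
    using Y Z' by (intro exI[of _ "Z' \<times> levels"]) (auto simp: subset_iff)
qed

text \<open>A partial bijection is a set of pairs, which makes the symmetry between the two sides and the union of
a chain immediate. The last two clauses say that it preserves the dimension of every subset.\<close>

definition partial_iso ::
  "('a set \<Rightarrow> bool) \<Rightarrow> ('a set \<Rightarrow> nat) \<Rightarrow> ('b set \<Rightarrow> bool) \<Rightarrow> ('b set \<Rightarrow> nat) \<Rightarrow> ('a \<times> 'b) set \<Rightarrow> bool"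
  where
  "partial_iso St w St' w' p \<longleftrightarrow> finite p \<and> inj_on fst p \<and> inj_on snd p \<and>
     St (fst ` p) \<and> St' (snd ` p) \<and>
     dominated p (\<lambda>q. predim w (fst ` q)) (\<lambda>q. predim w' (snd ` q)) \<and>
     dominated p (\<lambda>q. predim w' (snd ` q)) (\<lambda>q. predim w (fst ` q))"

lemma realizes_blowup:
  assumes "realizes St w (A \<times> {0}) (B \<times> levels) (blowup_edges A c B) (f \<circ> fst) g"
    and Y: "Y \<subseteq> B \<times> levels"
  shows "predim w (g ` Y) = predim (blowup A (\<lambda>T. w (f ` T)) c B) Y"
proof -
  have g: "inj_on g (B \<times> levels)" "\<And>z. z \<in> A \<times> {0} \<Longrightarrow> g z = f (fst z)"
    "\<And>T. T \<in> triples (B \<times> levels) \<Longrightarrow> \<not> T \<subseteq> A \<times> {0} \<Longrightarrow> w (g ` T) = of_bool (T \<in> blowup_edges A c B)"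
    using assms(1) by (auto simp: realizes_def)
  have "predim w (g ` Y) = predim (\<lambda>T. w (g ` T)) Y"
    using g(1) Y by (intro predim_image) (rule inj_on_subset)
  also have "\<dots> = predim (blowup A (\<lambda>T. w (f ` T)) c B) Y"
  proof (rule predim_cong)
    fix T assume "T \<in> triples Y"
    then have T: "T \<in> triples (B \<times> levels)" using triples_mono[OF Y] by blast
    show "w (g ` T) = blowup A (\<lambda>T. w (f ` T)) c B T"
    proof (cases "T \<subseteq> A \<times> {0}")
      case True
      then have "g ` T = f ` fst ` T" unfolding image_image using g(2) by (intro image_cong) auto
      then show ?thesis using True by (simp add: blowup_def)
    qed (use g(3)[OF T] in \<open>simp add: blowup_def\<close>)
  qed
  finally show ?thesis .
qed

text \<open>The forth step. Let \<open>B\<close> be a strong set containing the domain \<open>A\<close> and the point \<open>b\<close>. On the first side, \<open>B\<close>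
is extended by companions of its points and the links only. On the second side, the image of \<open>A\<close> is
extended by the remaining points of \<open>B\<close>, all companions, the links, and copies of the triples of \<open>B\<close>
outside \<open>A\<close>. Both blowups have the same labels and, by the preceding lemmas, the same dimension
function.\<close>

lemma partial_iso_extend_domain:
  fixes N N' :: "'a set"
  assumes "rich_structure N St w" "rich_structure N' St' w'"
    and p: "partial_iso St w St' w' p" and b: "b \<in> N"
  shows "\<exists>p'. p \<subseteq> p' \<and> partial_iso St w St' w' p' \<and> b \<in> fst ` p'"
proof -
  interpret S: rich_structure N St w by fact
  interpret S': rich_structure N' St' w' by fact
  have fin: "finite p" and inj: "inj_on fst p" "inj_on snd p" and St: "St (fst ` p)" "St' (snd ` p)"
    and dom: "dominated p (\<lambda>q. predim w (fst ` q)) (\<lambda>q. predim w' (snd ` q))"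
      "dominated p (\<lambda>q. predim w' (snd ` q)) (\<lambda>q. predim w (fst ` q))"
    using p by (auto simp: partial_iso_def)
  define A where "A = fst ` p"
  define f where "f x = snd (inv_into p fst x)" for x
  have f_fst: "f (fst z) = snd z" if "z \<in> p" for z
    using inj that by (simp add: f_def)
  have f_img: "f ` fst ` q = snd ` q" if "q \<subseteq> p" for q
    unfolding image_image using f_fst that by (intro image_cong) auto
  have inj_f: "inj_on f A"
    unfolding A_def using f_fst inj(2) by (auto simp: inj_on_def)
  \<comment> \<open>The structure on \<open>A\<close> pulled back from the second side.\<close>
  define u where "u T = w' (f ` T)" for T
  have u_fst: "predim u (fst ` q) = predim w' (snd ` q)" if "q \<subseteq> p" for q
  proof -
    have "inj_on f (fst ` q)" using inj_f that unfolding A_def by (meson image_mono inj_on_subset)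
    then show ?thesis using f_img[OF that] predim_image[of f "fst ` q" w'] by (simp add: u_def[abs_def])
  qed
  obtain B where B: "St B" "insert b A \<subseteq> B"
    using S.St_hull[of "insert b A"] fin b S.St_subset[OF St(1)] by (auto simp: A_def)
  have finB: "finite B" and BN: "B \<subseteq> N" and AB: "A \<subseteq> B" and bB: "b \<in> B"
    using B S.St_finite S.St_subset by auto
  have c: "w T \<le> 3" if "T \<in> triples B" for T
    using S.weight_le_3 triples_mono[OF BN] that by blast
  have "dominated A (predim w) (predim u)" "dominated A (predim u) (predim w)"
    unfolding A_def
    using dom dominated_cong[of p "\<lambda>q. predim w (fst ` q)" "\<lambda>q. predim w (fst ` q)"
        "\<lambda>q. predim w' (snd ` q)" "\<lambda>q. predim u (fst ` q)"]
      dominated_cong[of p "\<lambda>q. predim w' (snd ` q)" "\<lambda>q. predim u (fst ` q)"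
        "\<lambda>q. predim w (fst ` q)" "\<lambda>q. predim w (fst ` q)"] u_fst
    by (auto intro: dominated_image)
  then have "dominated B (glued A w w) (glued A u w)" "dominated B (glued A u w) (glued A w w)"
    by (simp_all add: glued_dominated[OF finB AB])
  \<comment> \<open>With the original weights, old or new makes no difference, so that all of \<open>B\<close> may be declared old.\<close>
  moreover have "glued A w w Z = glued B w w Z" if "Z \<subseteq> B" for Z
    using glued_self[of Z] finite_subset[OF that finB] by simp
  ultimately have "dominated B (glued B w w) (glued A u w)" "dominated B (glued A u w) (glued B w w)"
    using dominated_cong[of B "glued A w w" "glued B w w" "glued A u w" "glued A u w"]
      dominated_cong[of B "glued A u w" "glued A u w" "glued A w w" "glued B w w"] by auto
  then have domL: "dominated (B \<times> levels) (predim (blowup B w w B)) (predim (blowup A u w B))"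
      "dominated (B \<times> levels) (predim (blowup A u w B)) (predim (blowup B w w B))"
    by (auto intro!: blowup_dominated finB AB c)
  have "admissible (B \<times> {0}) (B \<times> levels) (blowup_edges B w B)"
  proof (rule admissible_blowup)
    fix Z assume "Z \<subseteq> B"
    then have "{T \<in> triples Z. \<not> T \<subseteq> B} = {}" by (auto simp: triples_def)
    then show "new_mass B w Z \<le> card (Z - B)" unfolding new_mass_def by (metis sum.empty zero_le)
  qed (use finB c in auto)
  moreover have "inj_on (id \<circ> fst) (B \<times> {0::nat})" "(id \<circ> fst) ` (B \<times> {0::nat}) = B"
    by (auto simp: inj_on_def)
  ultimately obtain g where
    g: "realizes St w (B \<times> {0}) (B \<times> levels) (blowup_edges B w B) (id \<circ> fst) g"
    using S.St_extend[of "B \<times> levels" "B \<times> {0}" "id \<circ> fst" "blowup_edges B w B"] finB B(1)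
    by fastforce
  have "admissible (A \<times> {0}) (B \<times> levels) (blowup_edges A w B)"
  proof (rule admissible_blowup)
    fix Z assume Z: "A \<subseteq> Z" "Z \<subseteq> B"
    then have finZ: "finite Z" using finB finite_subset by blast
    have "predim w A \<le> glued A w w Z"
      using S.St_le[of A Z] St Z BN finZ glued_self[OF finZ] by (simp add: A_def)
    then show "new_mass A w Z \<le> card (Z - A)"
      using Z by (simp add: glued_def Int_absorb1)
  qed (use finB c AB in auto)
  moreover have "inj_on (f \<circ> fst) (A \<times> {0::nat})" using inj_f by (auto simp: inj_on_def)
  moreover have "(f \<circ> fst) ` (A \<times> {0::nat}) = snd ` p"
  proof -
    have "(f \<circ> fst) ` (A \<times> {0::nat}) = f ` fst ` (A \<times> {0::nat})" by (simp only: image_comp)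
    then show ?thesis using f_img[of p] by (simp add: A_def)
  qed
  ultimately obtain g' where
    g': "realizes St' w' (A \<times> {0}) (B \<times> levels) (blowup_edges A w B) (f \<circ> fst) g'"
    using S'.St_extend[of "B \<times> levels" "A \<times> {0}" "f \<circ> fst" "blowup_edges A w B"] finB AB St(2)
    by fastforce
  define k where "k z = (g z, g' z)" for z
  define p' where "p' = k ` (B \<times> levels)"
  have fst_k: "fst ` k ` Y = g ` Y" and snd_k: "snd ` k ` Y = g' ` Y" for Y
    by (auto simp: k_def image_image)
  have predim_g: "predim w (fst ` k ` Y) = predim (blowup B w w B) Y"
    and predim_g': "predim w' (snd ` k ` Y) = predim (blowup A u w B) Y"
    if "Y \<subseteq> B \<times> levels" for Y
    using realizes_blowup[OF g that] realizes_blowup[OF g' that]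
    by (simp_all add: fst_k snd_k u_def[abs_def])
  have "dominated p' (\<lambda>q. predim w (fst ` q)) (\<lambda>q. predim w' (snd ` q))"
    "dominated p' (\<lambda>q. predim w' (snd ` q)) (\<lambda>q. predim w (fst ` q))"
    unfolding p'_def
    using domL dominated_cong[of "B \<times> levels" "\<lambda>Y. predim w (fst ` k ` Y)" "predim (blowup B w w B)"
        "\<lambda>Y. predim w' (snd ` k ` Y)" "predim (blowup A u w B)", OF predim_g predim_g']
      dominated_cong[of "B \<times> levels" "\<lambda>Y. predim w' (snd ` k ` Y)" "predim (blowup A u w B)"
        "\<lambda>Y. predim w (fst ` k ` Y)" "predim (blowup B w w B)", OF predim_g' predim_g]
    by (auto intro!: dominated_image)
  moreover have "inj_on fst p'" "inj_on snd p'"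
    unfolding p'_def using g g'
    by (auto intro!: inj_on_imageI simp: k_def comp_def realizes_def)
  moreover have "St (fst ` p')" "St' (snd ` p')"
    using g g' by (auto simp: p'_def fst_k snd_k realizes_def)
  moreover have "finite p'" using finB by (simp add: p'_def)
  ultimately have "partial_iso St w St' w' p'" by (simp add: partial_iso_def)
  moreover have k_old: "k (x, 0) = (x, f x)" if "x \<in> A" for x
    using g g' that AB by (auto simp: k_def realizes_def)
  have "p \<subseteq> p'"
  proof
    fix z assume z: "z \<in> p"
    then have "fst z \<in> A" "f (fst z) = snd z" using f_fst by (auto simp: A_def)
    then have "k (fst z, 0) = z" "(fst z, 0) \<in> B \<times> levels" using k_old[of "fst z"] AB by auto
    then show "z \<in> p'" unfolding p'_def by (metis image_eqI)
  qed
  moreover have "b \<in> fst ` p'"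
  proof -
    have "k (b, 0) \<in> p'" using bB by (auto simp: p'_def)
    moreover have "fst (k (b, 0)) = b" using g bB by (simp add: k_def realizes_def)
    ultimately show ?thesis by force
  qed
  ultimately show ?thesis by (intro exI[of _ p']) simp
qed

lemma swap_image: "fst ` prod.swap ` p = snd ` p" "snd ` prod.swap ` p = fst ` p"
  "prod.swap ` prod.swap ` p = p"
  by (simp_all add: image_image)

lemma partial_iso_swap:
  assumes "partial_iso St w St' w' p"
  shows "partial_iso St' w' St w (prod.swap ` p)"
proof -
  have "inj_on fst (prod.swap ` p)" "inj_on snd (prod.swap ` p)"
    using assms by (auto simp: partial_iso_def inj_on_def)
  moreover have "dominated (prod.swap ` p) (\<lambda>q. predim w' (fst ` q)) (\<lambda>q. predim w (snd ` q))"
    "dominated (prod.swap ` p) (\<lambda>q. predim w (snd ` q)) (\<lambda>q. predim w' (fst ` q))"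
    using assms by (auto intro!: dominated_image simp: partial_iso_def swap_image)
  ultimately show ?thesis using assms by (simp add: partial_iso_def swap_image)
qed

lemma partial_iso_extend_range:
  fixes N N' :: "'a set"
  assumes "rich_structure N St w" "rich_structure N' St' w'"
    and p: "partial_iso St w St' w' p" and b: "b \<in> N'"
  shows "\<exists>p'. p \<subseteq> p' \<and> partial_iso St w St' w' p' \<and> b \<in> snd ` p'"
proof -
  obtain q where q: "prod.swap ` p \<subseteq> q" "partial_iso St' w' St w q" "b \<in> fst ` q"
    using partial_iso_extend_domain[OF assms(2,1) partial_iso_swap[OF p] b] by auto
  have "p \<subseteq> prod.swap ` q" using image_mono[OF q(1), of prod.swap] by (simp only: swap_image)
  moreover have "b \<in> snd ` prod.swap ` q" using q(3) by (simp only: swap_image)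
  ultimately show ?thesis using partial_iso_swap[OF q(2)] by (intro exI[of _ "prod.swap ` q"]) simp
qed

section \<open>Back and forth\<close>

text \<open>The second conclusion records that \<open>F\<close> is approximated on every finite set by members of the system;
this transfers properties of the partial maps to \<open>F\<close>.\<close>

lemma back_and_forth:
  fixes G :: "('a \<times> 'b) set \<Rightarrow> bool"
  assumes countable: "countable M" "countable M'" and empty: "G {}"
    and partial: "\<And>p. G p \<Longrightarrow> p \<subseteq> M \<times> M' \<and> inj_on fst p \<and> inj_on snd p"
    and extend_domain: "\<And>p b. G p \<Longrightarrow> b \<in> M \<Longrightarrow> \<exists>p'. p \<subseteq> p' \<and> G p' \<and> b \<in> fst ` p'"
    and extend_range: "\<And>p b. G p \<Longrightarrow> b \<in> M' \<Longrightarrow> \<exists>p'. p \<subseteq> p' \<and> G p' \<and> b \<in> snd ` p'"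
  obtains F where "bij_betw F M M'"
    and "\<And>X. finite X \<Longrightarrow> X \<subseteq> M \<Longrightarrow> \<exists>p. G p \<and> X \<subseteq> fst ` p \<and> (\<forall>z\<in>p. snd z = F (fst z))"
proof -
  define e :: "nat \<Rightarrow> 'a" where "e = from_nat_into M"
  define e' :: "nat \<Rightarrow> 'b" where "e' = from_nat_into M'"
  have e: "\<exists>n. e n = x" if "x \<in> M" for x
    using from_nat_into_surj[OF countable(1) that] by (simp add: e_def)
  have e': "\<exists>n. e' n = y" if "y \<in> M'" for y
    using from_nat_into_surj[OF countable(2) that] by (simp add: e'_def)
  \<comment> \<open>If \<open>M\<close> or \<open>M'\<close> is empty, its enumeration takes a junk value; the membership guards take care of this.\<close>
  have "\<exists>P. \<forall>n. G (P n) \<and> (P n \<subseteq> P (Suc n) \<and>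
      (e n \<in> M \<longrightarrow> e n \<in> fst ` P (Suc n)) \<and> (e' n \<in> M' \<longrightarrow> e' n \<in> snd ` P (Suc n)))"
  proof (rule dependent_nat_choice)
    show "\<exists>p. G p" using empty by blast
    fix p n assume p: "G p"
    obtain q where q: "G q" "p \<subseteq> q" "e n \<in> M \<longrightarrow> e n \<in> fst ` q"
    proof (cases "e n \<in> M")
      case True
      then show ?thesis using extend_domain[OF p True] that by auto
    qed (use p that in auto)
    obtain r where r: "G r" "q \<subseteq> r" "e' n \<in> M' \<longrightarrow> e' n \<in> snd ` r"
    proof (cases "e' n \<in> M'")
      case True
      then show ?thesis using extend_range[OF q(1) True] that by auto
    qed (use q that in auto)
    have "p \<subseteq> r" using q r by auto
    moreover have "e n \<in> M \<longrightarrow> e n \<in> fst ` r" using q(3) image_mono[OF r(2), of fst] by auto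
    ultimately show "\<exists>r. G r \<and> (p \<subseteq> r \<and> (e n \<in> M \<longrightarrow> e n \<in> fst ` r) \<and> (e' n \<in> M' \<longrightarrow> e' n \<in> snd ` r))"
      using r by auto
  qed
  then obtain P where G: "\<And>n. G (P n)" and step: "\<And>n. P n \<subseteq> P (Suc n)"
    and hit: "\<And>n. e n \<in> M \<Longrightarrow> e n \<in> fst ` P (Suc n)" "\<And>n. e' n \<in> M' \<Longrightarrow> e' n \<in> snd ` P (Suc n)"
    by auto
  have mono: "P m \<subseteq> P n" if "m \<le> n" for m n
    using lift_Suc_mono_le[of P, OF step that] .
  define Q where "Q = (\<Union>n. P n)"
  have pair: "\<exists>n. z \<in> P n \<and> z' \<in> P n" if zz: "z \<in> Q" "z' \<in> Q" for z z'
  proof -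
    obtain m n where "z \<in> P m" "z' \<in> P n" using zz unfolding Q_def by blast
    then have "z \<in> P (max m n)" "z' \<in> P (max m n)"
      using mono[of m "max m n"] mono[of n "max m n"] by auto
    then show ?thesis by auto
  qed
  have unique: "y = y'" if "(x, y) \<in> Q" "(x, y') \<in> Q" for x y y'
    using pair[OF that] partial[OF G] by (fastforce simp: inj_on_def)
  have unique': "x = x'" if "(x, y) \<in> Q" "(x', y) \<in> Q" for x x' y
    using pair[OF that] partial[OF G] by (fastforce simp: inj_on_def)
  have QM: "Q \<subseteq> M \<times> M'" using partial[OF G] by (auto simp: Q_def)
  define F where "F x = (SOME y. (x, y) \<in> Q)" for x
  have F: "F x = y" if "(x, y) \<in> Q" for x y
    unfolding F_def using that unique by (intro some_equality) auto
  have dom: "\<exists>n y. (x, y) \<in> P n" if x: "x \<in> M" for x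
  proof -
    obtain n where "e n = x" using e[OF x] by auto
    then have "x \<in> fst ` P (Suc n)" using hit(1)[of n] x by auto
    then show ?thesis by force
  qed
  have ran: "\<exists>n x. (x, y) \<in> P n" if y: "y \<in> M'" for y
  proof -
    obtain n where "e' n = y" using e'[OF y] by auto
    then have "y \<in> snd ` P (Suc n)" using hit(2)[of n] y by auto
    then show ?thesis by force
  qed
  have FQ: "(x, F x) \<in> Q" if "x \<in> M" for x
    using dom[OF that] F by (auto simp: Q_def)
  have "bij_betw F M M'"
  proof (rule bij_betw_imageI)
    show "inj_on F M" using FQ unique' by (metis inj_onI)
    show "F ` M = M'"
    proof
      show "F ` M \<subseteq> M'" using FQ QM by auto
      show "M' \<subseteq> F ` M"
      proof
        fix y assume "y \<in> M'"
        then obtain n x where "(x, y) \<in> P n" using ran[of y] by auto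
        then have "(x, y) \<in> Q" by (auto simp: Q_def)
        then show "y \<in> F ` M" using F[of x y] QM by auto
      qed
    qed
  qed
  moreover have "\<exists>p. G p \<and> X \<subseteq> fst ` p \<and> (\<forall>z\<in>p. snd z = F (fst z))"
    if X: "finite X" "X \<subseteq> M" for X
  proof -
    have "\<exists>n. X \<subseteq> fst ` P n"
      using X
    proof (induction X rule: finite_induct)
      case (insert x X)
      then obtain m where m: "X \<subseteq> fst ` P m" by auto
      obtain n y where "(x, y) \<in> P n" using dom[of x] insert.prems by auto
      then have "x \<in> fst ` P n" by force
      then have "insert x X \<subseteq> fst ` P (max m n)"
        using m image_mono[OF mono[of m "max m n"], of fst] image_mono[OF mono[of n "max m n"], of fst]
        by auto
      then show ?case by auto
    qed simp
    then obtain n where "X \<subseteq> fst ` P n" by auto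
    moreover have "\<forall>z\<in>P n. snd z = F (fst z)"
    proof
      fix z assume "z \<in> P n"
      then have "(fst z, snd z) \<in> Q" unfolding prod.collapse Q_def by blast
      then show "snd z = F (fst z)" using F[of "fst z" "snd z"] by simp
    qed
    ultimately show ?thesis using G by auto
  qed
  ultimately show thesis by (rule that)
qed

text \<open>Inside strong sets the dimension is attained, so domination becomes an inequality between the
dimensions of the two ambient structures.\<close>

lemma partial_iso_dimension_le:
  assumes "rich_structure N St w" "rich_structure N' St' w'"
    and p: "partial_iso St w St' w' p" and q: "q \<subseteq> p"
  shows "dimension (predim w') N' (snd ` q) \<le> dimension (predim w) N (fst ` q)"
proof -
  interpret S: rich_structure N St w by fact
  interpret S': rich_structure N' St' w' by fact
  have St: "St (fst ` p)" "St' (snd ` p)"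
    and dom: "dominated p (\<lambda>q. predim w (fst ` q)) (\<lambda>q. predim w' (snd ` q))"
    using p by (auto simp: partial_iso_def)
  have fin: "finite p" using p by (simp add: partial_iso_def)
  obtain C where C: "fst ` q \<subseteq> C" "C \<subseteq> fst ` p"
      "dimension (predim w) N (fst ` q) = predim w C"
    using S.dimension_attained_in_strong[OF St(1) image_mono[OF q]] by auto
  define r where "r = {z \<in> p. fst z \<in> C}"
  have r: "q \<subseteq> r" "r \<subseteq> p" "fst ` r = C" using C q by (auto simp: r_def)
  obtain t where t: "r \<subseteq> t" "t \<subseteq> p" "predim w' (snd ` t) \<le> predim w (fst ` r)"
    using dominatedD[OF dom r(2)] by auto
  have "dimension (predim w') N' (snd ` q) \<le> predim w' (snd ` t)"
  proof (rule S'.dimension_le)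
    show "finite (snd ` q)" "finite (snd ` t)"
      using finite_subset[OF q fin] finite_subset[OF t(2) fin] by auto
    show "snd ` t \<subseteq> N'" using S'.St_subset[OF St(2)] t(2) by auto
    then show "snd ` q \<subseteq> N'" using r(1) t(1) by auto
    show "snd ` q \<subseteq> snd ` t" using r(1) t(1) by auto
  qed
  then show ?thesis using t(3) r(3) C(3) by simp
qed

lemma rich_structures_dimension_iso:
  fixes N N' :: "'a set"
  assumes rich: "rich_structure N St w" "rich_structure N' St' w'"
    and "countable N" "countable N'"
  shows "\<exists>F. bij_betw F N N' \<and> (\<forall>X. finite X \<longrightarrow> X \<subseteq> N \<longrightarrow>
    dimension (predim w') N' (F ` X) = dimension (predim w) N X)"
proof -
  interpret S: rich_structure N St w by fact
  interpret S': rich_structure N' St' w' by fact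
  have empty: "partial_iso St w St' w' {}"
    using S.St_empty S'.St_empty by (simp add: partial_iso_def dominated_def predim_def mass_def triples_small)
  have partial: "p \<subseteq> N \<times> N' \<and> inj_on fst p \<and> inj_on snd p" if "partial_iso St w St' w' p" for p
    using S.St_subset[of "fst ` p"] S'.St_subset[of "snd ` p"] that by (auto simp: partial_iso_def)
  obtain F where F: "bij_betw F N N'"
    and ext: "\<And>X. finite X \<Longrightarrow> X \<subseteq> N \<Longrightarrow>
      \<exists>p. partial_iso St w St' w' p \<and> X \<subseteq> fst ` p \<and> (\<forall>z\<in>p. snd z = F (fst z))"
    using back_and_forth[OF assms(3,4) empty partial partial_iso_extend_domain[OF rich] partial_iso_extend_range[OF rich]] by metis
  have "dimension (predim w') N' (F ` X) = dimension (predim w) N X" if X: "finite X" "X \<subseteq> N" for X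
  proof -
    obtain p where p: "partial_iso St w St' w' p" "X \<subseteq> fst ` p" "\<forall>z\<in>p. snd z = F (fst z)"
      using ext[OF X] by auto
    define q where "q = {z \<in> p. fst z \<in> X}"
    have q: "q \<subseteq> p" "fst ` q = X" using p(2) by (auto simp: q_def)
    have "snd ` q = F ` fst ` q"
      unfolding image_image using p(3) q(1) by (intro image_cong) auto
    then have q': "snd ` q = F ` X" using q(2) by simp
    have "dimension (predim w') N' (snd ` q) \<le> dimension (predim w) N (fst ` q)"
      by (rule partial_iso_dimension_le[OF rich p(1) q(1)])
    moreover have "dimension (predim w) N (snd ` prod.swap ` q)
        \<le> dimension (predim w') N' (fst ` prod.swap ` q)"
      by (rule partial_iso_dimension_le[OF rich(2,1) partial_iso_swap[OF p(1)] image_mono[OF q(1)]])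
    ultimately show ?thesis using q(2) q' by (simp add: swap_image)
  qed
  then show ?thesis using F by (intro exI[of _ F]) simp
qed

section \<open>From dimension to geometry\<close>

text \<open>Closure is defined through dimensions of finite sets, so a bijection that preserves these carries
closures to closures.\<close>

lemma dim_closure_iso:
  assumes F: "bij_betw F M M'"
    and dm: "\<And>X. finite X \<Longrightarrow> X \<subseteq> M \<Longrightarrow> dm' (F ` X) = dm X" and X: "X \<subseteq> M"
  shows "dim_closure dm' M' (F ` X) = F ` dim_closure dm M X"
proof -
  have "F a \<in> dim_closure dm' M' (F ` X) \<longleftrightarrow> a \<in> dim_closure dm M X" if a: "a \<in> M" for a
  proof -
    have "F a \<in> M'" using F a by (auto simp: bij_betw_def)
    have "(\<exists>Y. finite Y \<and> Y \<subseteq> F ` X \<and> dm' (Y \<union> {F a}) = dm' Y)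
        \<longleftrightarrow> (\<exists>X0. finite X0 \<and> X0 \<subseteq> X \<and> dm' (F ` X0 \<union> {F a}) = dm' (F ` X0))"
      by (metis finite_imageI finite_subset_image image_mono)
    also have "\<dots> \<longleftrightarrow> (\<exists>X0. finite X0 \<and> X0 \<subseteq> X \<and> dm (X0 \<union> {a}) = dm X0)"
    proof (intro ex_cong1 conj_cong refl)
      fix X0 assume X0: "finite X0" "X0 \<subseteq> X"
      then show "dm' (F ` X0 \<union> {F a}) = dm' (F ` X0) \<longleftrightarrow> dm (X0 \<union> {a}) = dm X0"
        using dm[of X0] dm[of "X0 \<union> {a}"] X a by auto
    qed
    finally show ?thesis using a \<open>F a \<in> M'\<close> by (simp add: dim_closure_def)
  qed
  moreover have "dim_closure dm' M' (F ` X) \<subseteq> F ` M" "dim_closure dm M X \<subseteq> M"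
    using F by (auto simp: dim_closure_def bij_betw_def)
  ultimately show ?thesis by blast
qed

text \<open>The isomorphism sends a class of points to its image. Equality of closures and membership in the closure
of the empty set are preserved, so classes go to classes.\<close>

lemma geometry_isomorphicI:
  assumes F: "bij_betw F M M'"
    and sub: "\<And>X. X \<subseteq> M \<Longrightarrow> cl X \<subseteq> M"
    and cl: "\<And>X. X \<subseteq> M \<Longrightarrow> cl' (F ` X) = F ` cl X"
  shows "geometry_isomorphic (associated_geometry cl M) (associated_geometry cl' M')"
proof -
  let ?s = "same_closure cl M" and ?s' = "same_closure cl' M'"
  have inj: "inj_on F M" and img: "F ` M = M'" using F by (auto simp: bij_betw_def)
  have inj_img: "F ` X = F ` Y \<longleftrightarrow> X = Y" if "X \<subseteq> M" "Y \<subseteq> M" for X Y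
    using inj_on_image_eq_iff[OF inj that] .
  have cl0: "cl' {} = F ` cl {}" using cl[of "{}"] by simp
  have loops: "M' - cl' {} = F ` (M - cl {})"
    unfolding cl0 img[symmetric] using inj sub[of "{}"] by (simp add: inj_on_image_set_diff)
  have same: "F a \<in> M' - cl' {} \<and> cl' {F a} = cl' {F b} \<longleftrightarrow> a \<in> M - cl {} \<and> cl {a} = cl {b}"
    if "a \<in> M" "b \<in> M" for a b
  proof -
    have "F a \<in> M' - cl' {} \<longleftrightarrow> a \<in> M - cl {}"
      unfolding loops using inj that(1) by (auto simp: inj_on_def)
    moreover have "cl' {F a} = cl' {F b} \<longleftrightarrow> cl {a} = cl {b}"
      using cl[of "{a}"] cl[of "{b}"] inj_img[of "cl {a}" "cl {b}"] sub[of "{a}"] sub[of "{b}"] that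
      by simp
    ultimately show ?thesis by simp
  qed
  have cls: "F ` (?s `` {x}) = ?s' `` {F x}" if x: "x \<in> M" for x
  proof
    show "F ` (?s `` {x}) \<subseteq> ?s' `` {F x}"
    proof
      fix z assume "z \<in> F ` (?s `` {x})"
      then obtain y where y: "(x, y) \<in> ?s" "z = F y" by auto
      then have "y \<in> M" by (simp add: same_closure_def)
      then show "z \<in> ?s' `` {F x}"
        using y same[OF x \<open>y \<in> M\<close>] same[OF \<open>y \<in> M\<close> x] by (auto simp: same_closure_def)
    qed
    show "?s' `` {F x} \<subseteq> F ` (?s `` {x})"
    proof
      fix z assume z: "z \<in> ?s' `` {F x}"
      then have "z \<in> M'" by (simp add: same_closure_def)
      then obtain y where y: "y \<in> M" "z = F y" using img by auto
      then have "(x, y) \<in> ?s"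
        using z same[OF x y(1)] same[OF y(1) x] x by (auto simp: same_closure_def)
      then show "z \<in> F ` (?s `` {x})" using y by auto
    qed
  qed
  have quot: "image F ` (Y // ?s) = F ` Y // ?s'" if "Y \<subseteq> M" for Y
  proof -
    have "image F ` (Y // ?s) = (\<lambda>x. F ` (?s `` {x})) ` Y"
      by (auto simp: quotient_def)
    also have "\<dots> = (\<lambda>x. ?s' `` {F x}) ` Y" using cls that by (intro image_cong) auto
    also have "\<dots> = F ` Y // ?s'" by (auto simp: quotient_def)
    finally show ?thesis .
  qed
  have pointsM: "\<Union>P \<subseteq> M" if "P \<subseteq> geom_points cl M" for P
    using that by (auto simp: geom_points_def quotient_def same_closure_def)
  have "bij_betw (image F) (geom_points cl M) (geom_points cl' M')"
  proof (rule bij_betw_imageI)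
    show "inj_on (image F) (geom_points cl M)"
    proof (rule inj_onI)
      fix X Y assume "X \<in> geom_points cl M" "Y \<in> geom_points cl M" "F ` X = F ` Y"
      moreover from this have "X \<subseteq> M" "Y \<subseteq> M" using pointsM[of "geom_points cl M"] by auto
      ultimately show "X = Y" using inj_img by simp
    qed
    show "image F ` geom_points cl M = geom_points cl' M'"
      unfolding geom_points_def loops by (rule quot) auto
  qed
  moreover have "image F ` geom_closure cl M P = geom_closure cl' M' (image F ` P)"
    if "P \<subseteq> geom_points cl M" for P
  proof -
    have P: "\<Union>P \<subseteq> M" using pointsM[OF that] .
    have "cl' (\<Union>(image F ` P)) = F ` cl (\<Union>P)" using cl[OF P] by (simp add: image_Union)
    then have "cl' (\<Union>(image F ` P)) - cl' {} = F ` (cl (\<Union>P) - cl {})"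
      using inj_on_image_set_diff[OF inj, of "cl (\<Union>P)" "cl {}"] sub[OF P] sub[of "{}"] cl0 by auto
    then show ?thesis
      unfolding geom_closure_def using quot[of "cl (\<Union>P) - cl {}"] sub[OF P] by auto
  qed
  ultimately show ?thesis
    unfolding geometry_isomorphic_def associated_geometry_def by auto
qed

section \<open>The generic structure and its symmetrization\<close>

fun tset :: "'a \<times> 'a \<times> 'a \<Rightarrow> 'a set" where
  "tset (a, b, c) = {a, b, c}"

definition orderings :: "('a \<times> 'a \<times> 'a) set \<Rightarrow> 'a set \<Rightarrow> nat" where
  "orderings R T = card {t \<in> R. tset t = T}"

definition irredundant :: "('a \<times> 'a \<times> 'a) set \<Rightarrow> bool" where
  "irredundant R \<longleftrightarrow> (\<forall>t\<in>R. card (tset t) = 3)"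

lemma is_structure_iff: "is_structure N R \<longleftrightarrow> (\<forall>t\<in>R. tset t \<subseteq> N) \<and> irredundant R"
proof -
  have "card {a, b, c} = 3 \<longleftrightarrow> a \<noteq> b \<and> a \<noteq> c \<and> b \<noteq> c" for a b c :: 'a
    by (auto simp: card_insert_if)
  then have "irredundant R \<longleftrightarrow> (\<forall>a b c. (a, b, c) \<in> R \<longrightarrow> a \<noteq> b \<and> a \<noteq> c \<and> b \<noteq> c)"
    by (simp add: irredundant_def Ball_def)
  moreover have "R \<subseteq> N \<times> N \<times> N \<longleftrightarrow> (\<forall>t\<in>R. tset t \<subseteq> N)"
    by (auto simp: Ball_def)
  ultimately show ?thesis by (simp add: is_structure_def conj_commute)
qed

lemma finite_orderings: "finite T \<Longrightarrow> finite {t \<in> R. tset t = T}"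
  by (rule finite_subset[of _ "T \<times> T \<times> T"]) auto

lemma d0_eq_predim:
  assumes "irredundant R" "finite X"
  shows "d0 R X = predim (orderings R) X"
proof -
  have "induced R X = (\<Union>T\<in>triples X. {t \<in> R. tset t = T})"
    using assms(1) by (auto simp: induced_def irredundant_def triples_def)
  moreover have "finite {t \<in> R. tset t = T}" if "T \<in> triples X" for T
  proof -
    have "finite T" using that by (auto simp: triples_def card_ge_0_finite)
    then show ?thesis by (rule finite_orderings)
  qed
  ultimately have "card (induced R X) = mass (orderings R) X"
    unfolding mass_def orderings_def using assms(2) by (simp only:) (rule card_UN_disjoint, auto)
  then show ?thesis by (simp add: d0_def predim_def)
qed

lemma orderings_embedding:
  assumes f: "embedding f A R B S" and T: "T \<subseteq> A"
  shows "orderings S (f ` T) = orderings R T"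
proof -
  have inj: "inj_on f A" and rel: "\<And>a b c. a \<in> A \<Longrightarrow> b \<in> A \<Longrightarrow> c \<in> A \<Longrightarrow>
      (a, b, c) \<in> R \<longleftrightarrow> (f a, f b, f c) \<in> S"
    using f by (auto simp: embedding_def)
  let ?F = "\<lambda>(a, b, c). (f a, f b, f c)"
  have "bij_betw ?F {t \<in> R. tset t = T} {t \<in> S. tset t = f ` T}"
  proof (rule bij_betw_imageI)
    have "inj_on ?F {t. tset t \<subseteq> A}"
      using inj by (auto simp: inj_on_def)
    then show "inj_on ?F {t \<in> R. tset t = T}"
      by (rule inj_on_subset) (use T in auto)
    show "?F ` {t \<in> R. tset t = T} = {t \<in> S. tset t = f ` T}"
    proof (intro equalityI subsetI)
      fix t assume "t \<in> ?F ` {t \<in> R. tset t = T}"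
      then obtain a b c where t: "t = (f a, f b, f c)" "(a, b, c) \<in> R" "{a, b, c} = T"
        by (auto simp: split_paired_all)
      then have "a \<in> A" "b \<in> A" "c \<in> A" using T by auto
      then have "t \<in> S" using t rel by simp
      then show "t \<in> {t \<in> S. tset t = f ` T}" using t by auto
    next
      fix t assume "t \<in> {t \<in> S. tset t = f ` T}"
      then obtain x y z where t: "t = (x, y, z)" "(x, y, z) \<in> S" "{x, y, z} = f ` T"
        by (cases t) auto
      then have "x \<in> f ` T" "y \<in> f ` T" "z \<in> f ` T" by auto
      then obtain a b c where abc: "a \<in> T" "b \<in> T" "c \<in> T" "x = f a" "y = f b" "z = f c" by auto
      then have "f ` {a, b, c} = f ` T" using t by simp
      then have "{a, b, c} = T" using inj_on_image_eq_iff[OF inj, of "{a, b, c}" T] abc T by auto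
      moreover have "(a, b, c) \<in> R" using rel[of a b c] abc T t by auto
      ultimately show "t \<in> ?F ` {t \<in> R. tset t = T}"
        using t(1) abc by (intro image_eqI[of _ _ "(a, b, c)"]) auto
    qed
  qed
  then show ?thesis unfolding orderings_def by (simp add: bij_betw_same_card)
qed

text \<open>The structure to be embedded is built on labels first: on \<open>L0\<close> it is the relation pulled back from
\<open>M\<close>, and each new edge receives one arbitrary ordering, so that it has weight \<open>1\<close>. Admissibility makes
\<open>L0\<close> strong in it, and then submodularity gives nonnegativity of its predimension. It is finally transported
to natural numbers, where the extension property of \<open>M\<close> applies.\<close>

lemma generic_extend:
  fixes L :: "'l set"
  assumes M: "hrushovski_generic M R"
    and L: "finite L" "L0 \<subseteq> L" "inj_on h L0" and A: "strong (h ` L0) M R"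
    and E: "admissible L0 L E"
  shows "\<exists>g. realizes (\<lambda>A. strong A M R) (orderings R) L0 L E h g"
proof -
  have irr: "irredundant R" and RM: "\<And>t. t \<in> R \<Longrightarrow> tset t \<subseteq> M"
    using M by (auto simp: hrushovski_generic_def is_structure_iff)
  have E_sub: "E \<subseteq> triples L" and E_new: "\<And>T. T \<in> E \<Longrightarrow> \<not> T \<subseteq> L0"
    and E_le: "\<And>Y. L0 \<subseteq> Y \<Longrightarrow> Y \<subseteq> L \<Longrightarrow> card {T \<in> E. T \<subseteq> Y} \<le> card (Y - L0)"
    using E by (auto simp: admissible_def)
  have "\<exists>t. tset t = T" if "T \<in> E" for T
  proof -
    have "card T = 3" using that E_sub by (auto simp: triples_def)
    then obtain a b c where "T = {a, b, c}" by (auto simp: card_3_iff)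
    then have "tset (a, b, c) = T" by simp
    then show ?thesis ..
  qed
  then obtain orient where orient: "\<And>T. T \<in> E \<Longrightarrow> tset (orient T) = T" by metis
  define S0 where "S0 = {(x, y, z). x \<in> L0 \<and> y \<in> L0 \<and> z \<in> L0 \<and> (h x, h y, h z) \<in> R} \<union> orient ` E"
  define u where "u = orderings S0"
  have S0_L: "tset t \<subseteq> L" if t: "t \<in> S0" for t
  proof -
    consider x y z where "t = (x, y, z)" "{x, y, z} \<subseteq> L0" | T where "T \<in> E" "t = orient T"
      using t by (auto simp: S0_def)
    then show ?thesis
    proof cases
      case 2
      then have "tset t = T" using orient by simp
      then show ?thesis using 2 E_sub by (auto simp: triples_def)
    qed (use L(2) in auto)
  qed
  have S0_irr: "irredundant S0"
    unfolding irredundant_def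
  proof
    fix t assume "t \<in> S0"
    then consider x y z where "t = (x, y, z)" "(h x, h y, h z) \<in> R" | T where "T \<in> E" "t = orient T"
      by (auto simp: S0_def)
    then show "card (tset t) = 3"
    proof cases
      case 1
      have "card {h x, h y, h z} = 3" using irr 1(2) by (fastforce simp: irredundant_def)
      then have "card (h ` {x, y, z}) = 3" by simp
      then have "card {x, y, z} \<ge> 3" using card_image_le[of "{x, y, z}" h] by simp
      moreover have "card {x, y, z} \<le> 3" by (simp add: card_insert_if)
      ultimately show ?thesis using 1(1) by simp
    next
      case 2
      then show ?thesis using orient E_sub by (auto simp: triples_def)
    qed
  qed
  have orient_L0: "(x, y, z) \<notin> orient ` E" if "x \<in> L0" "y \<in> L0" "z \<in> L0" for x y z
  proof
    assume "(x, y, z) \<in> orient ` E"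
    then obtain T where "T \<in> E" "orient T = (x, y, z)" by auto
    then have "T = {x, y, z}" using orient by force
    then show False using E_new[OF \<open>T \<in> E\<close>] that by auto
  qed
  have "embedding h L0 S0 M R"
    unfolding embedding_def using L(3) A orient_L0 by (auto simp: S0_def strong_def)
  then have u_old: "u T = orderings R (h ` T)" if "T \<subseteq> L0" for T
    unfolding u_def using orderings_embedding that by metis
  have u_new: "u T = of_bool (T \<in> E)" if "\<not> T \<subseteq> L0" for T
  proof -
    have "T \<in> E \<and> t = orient T" if t: "t \<in> S0" "tset t = T" for t
    proof -
      have "t \<in> orient ` E" using t \<open>\<not> T \<subseteq> L0\<close> by (auto simp: S0_def)
      then show ?thesis using t(2) orient by auto
    qed
    moreover have "orient T \<in> S0 \<and> tset (orient T) = T" if "T \<in> E"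
      using that orient by (auto simp: S0_def)
    ultimately have "{t \<in> S0. tset t = T} = (if T \<in> E then {orient T} else {})"
      by (cases "T \<in> E") (simp_all only: if_True if_False, blast+)
    then show ?thesis by (simp add: u_def orderings_def)
  qed
  have u_pos: "0 \<le> predim u Y" if "Y \<subseteq> L0" for Y
  proof -
    have inj: "inj_on h Y" using L(3) that by (rule inj_on_subset)
    have sub: "finite (h ` Y)" "h ` Y \<subseteq> M"
      using A that L finite_subset[of Y L] by (auto simp: strong_def)
    then have "in_class_C (h ` Y) (induced R (h ` Y))" using M by (auto simp: hrushovski_generic_def)
    then have "d0 (induced R (h ` Y)) {} \<le> d0 (induced R (h ` Y)) (h ` Y)"
      using sub by (auto simp: in_class_C_def strong_def)
    then have "0 \<le> d0 R (h ` Y)" by (simp add: d0_def induced_def)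
    also have "d0 R (h ` Y) = predim (\<lambda>T. orderings R (h ` T)) Y"
      using d0_eq_predim[OF irr sub(1)] predim_image[OF inj] by simp
    also have "\<dots> = predim u Y"
      using u_old that by (intro predim_cong) (auto simp: triples_def)
    finally show ?thesis .
  qed
  have u_strong: "predim u L0 \<le> predim u Y" if "L0 \<subseteq> Y" "Y \<subseteq> L" for Y
  proof -
    have fin: "finite Y" "finite L0"
      using finite_subset[OF that(2) L(1)] finite_subset[OF L(2,1)] by simp_all
    have "new_mass L0 u Y = (\<Sum>T | T \<in> triples Y \<and> \<not> T \<subseteq> L0. of_bool (T \<in> E))"
      unfolding new_mass_def using u_new by (intro sum.cong) auto
    also have "\<dots> = card {T \<in> {T \<in> triples Y. \<not> T \<subseteq> L0}. T \<in> E}"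
      using fin by (simp add: sum.If_cases of_bool_def Int_def)
    also have "{T \<in> {T \<in> triples Y. \<not> T \<subseteq> L0}. T \<in> E} = {T \<in> E. T \<subseteq> Y}"
      using E_new E_sub by (auto simp: triples_def)
    finally have "new_mass L0 u Y \<le> card (Y - L0)" using E_le[OF that] by simp
    moreover have "card Y = card L0 + card (Y - L0)"
      using card_Int_Diff[OF fin(1), of L0] that(1) by (simp add: Int_absorb1)
    ultimately show ?thesis
      using mass_split[OF fin(1), of u L0] that(1) by (simp add: predim_def Int_absorb1)
  qed
  have u_nonneg: "0 \<le> predim u Y" if "Y \<subseteq> L" for Y
  proof -
    have "finite Y" "finite L0"
      using finite_subset[OF that L(1)] finite_subset[OF L(2,1)] by simp_all
    then have "predim u (Y \<union> L0) + predim u (Y \<inter> L0) \<le> predim u Y + predim u L0"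
      by (rule predim_submodular)
    then show ?thesis using u_strong[of "Y \<union> L0"] u_pos[of "Y \<inter> L0"] that L(2) by simp
  qed
  obtain \<phi> :: "'l \<Rightarrow> nat" where \<phi>: "inj_on \<phi> L"
    using finite_imp_inj_to_nat_seg[OF L(1)] by auto
  define S where "S = (\<lambda>(x, y, z). (\<phi> x, \<phi> y, \<phi> z)) ` S0"
  have S_iff: "(\<phi> x, \<phi> y, \<phi> z) \<in> S \<longleftrightarrow> (x, y, z) \<in> S0" if "x \<in> L" "y \<in> L" "z \<in> L" for x y z
  proof
    assume "(\<phi> x, \<phi> y, \<phi> z) \<in> S"
    then obtain a b c where abc: "(a, b, c) \<in> S0" "\<phi> x = \<phi> a" "\<phi> y = \<phi> b" "\<phi> z = \<phi> c"
      by (auto simp: S_def)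
    then have "a \<in> L" "b \<in> L" "c \<in> L" using S0_L[OF abc(1)] by auto
    then have "x = a" "y = b" "z = c" using abc(2-4) that inj_onD[OF \<phi>] by simp_all
    then show "(x, y, z) \<in> S0" using abc(1) by simp
  qed (force simp: S_def)
  have emb: "embedding \<phi> L S0 (\<phi> ` L) S"
    unfolding embedding_def using \<phi> S_iff by simp
  have S_irr: "irredundant S" and S_sub: "\<And>t. t \<in> S \<Longrightarrow> tset t \<subseteq> \<phi> ` L"
  proof -
    have *: "card (tset t) = 3 \<and> tset t \<subseteq> \<phi> ` L" if t: "t \<in> S" for t
    proof -
      obtain x y z where xyz: "(x, y, z) \<in> S0" "t = (\<phi> x, \<phi> y, \<phi> z)" using t by (auto simp: S_def)
      have sub: "{x, y, z} \<subseteq> L" using S0_L[OF xyz(1)] by simp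
      have "card {x, y, z} = 3" using S0_irr xyz(1) by (force simp: irredundant_def)
      then have "card (\<phi> ` {x, y, z}) = 3" using card_image[OF inj_on_subset[OF \<phi> sub]] by simp
      then show ?thesis using xyz(2) sub by auto
    qed
    then show "irredundant S" "\<And>t. t \<in> S \<Longrightarrow> tset t \<subseteq> \<phi> ` L" by (auto simp: irredundant_def)
  qed
  have d0_S: "d0 S (\<phi> ` Y) = predim u Y" if "Y \<subseteq> L" for Y
  proof -
    have "finite (\<phi> ` Y)" using L(1) finite_subset[OF that] by simp
    then have "d0 S (\<phi> ` Y) = predim (\<lambda>T. orderings S (\<phi> ` T)) Y"
      using d0_eq_predim[OF S_irr] predim_image[OF inj_on_subset[OF \<phi> that]] by simp
    also have "\<dots> = predim u Y"
      unfolding u_def using orderings_embedding[OF emb] that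
      by (intro predim_cong) (auto simp: triples_def)
    finally show ?thesis .
  qed
  have inC: "in_class_C (\<phi> ` L) S"
  proof -
    have "is_structure (\<phi> ` L) S" using S_irr S_sub by (simp add: is_structure_iff)
    moreover have "d0 S {} \<le> d0 S B" if B: "B \<subseteq> \<phi> ` L" for B
    proof -
      obtain Y where "Y \<subseteq> L" "B = \<phi> ` Y" using B by (auto simp: subset_image_iff)
      then show ?thesis using d0_S u_nonneg by (simp add: d0_def[of S "{}"] induced_def)
    qed
    ultimately show ?thesis using L(1) by (simp add: in_class_C_def strong_def)
  qed
  define f where "f = \<phi> \<circ> inv_into L0 h"
  have f_h: "f (h x) = \<phi> x" if "x \<in> L0" for x
    using L(3) that by (simp add: f_def)
  have f_img: "f ` h ` L0 = \<phi> ` L0"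
    unfolding image_image using f_h by (intro image_cong) auto
  have f_emb: "embedding f (h ` L0) R (\<phi> ` L) S"
    unfolding embedding_def
  proof (intro conjI)
    show "inj_on f (h ` L0)" using f_h \<phi> L(2) by (auto simp: inj_on_def)
    show "f ` h ` L0 \<subseteq> \<phi> ` L" using f_img L(2) by auto
    have "(h x, h y, h z) \<in> R \<longleftrightarrow> (f (h x), f (h y), f (h z)) \<in> S"
      if "x \<in> L0" "y \<in> L0" "z \<in> L0" for x y z
      using S_iff[of x y z] orient_L0[OF that] that L(2) f_h by (auto simp: S0_def)
    then show "\<forall>a\<in>h ` L0. \<forall>b\<in>h ` L0. \<forall>c\<in>h ` L0. ((a, b, c) \<in> R) = ((f a, f b, f c) \<in> S)"
      by auto
  qed
  have f_strong: "strong (f ` h ` L0) (\<phi> ` L) S"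
    unfolding strong_def f_img
  proof (intro conjI allI impI)
    show "finite (\<phi> ` L0)" "\<phi> ` L0 \<subseteq> \<phi> ` L" using L finite_subset by auto
    fix B assume B: "finite B \<and> \<phi> ` L0 \<subseteq> B \<and> B \<subseteq> \<phi> ` L"
    then obtain Y where Y: "Y \<subseteq> L" "B = \<phi> ` Y" by (auto simp: subset_image_iff)
    have "L0 \<subseteq> Y"
    proof
      fix x assume x: "x \<in> L0"
      then have "x \<in> L" "\<phi> x \<in> \<phi> ` Y" using L(2) B Y(2) by auto
      then show "x \<in> Y" using inj_on_image_mem_iff[OF \<phi> _ Y(1)] by simp
    qed
    then show "d0 S (\<phi> ` L0) \<le> d0 S B" using d0_S u_strong Y L(2) by simp
  qed
  have extension: "\<exists>g. embedding g B S M R \<and> (\<forall>a\<in>A. g (f a) = a) \<and> strong (g ` B) M R"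
    if "strong A M R" "in_class_C B S" "embedding f A R B S" "strong (f ` A) B S"
    for A f and B :: "nat set" and S
    using M that by (simp add: hrushovski_generic_def)
  obtain g where g: "embedding g (\<phi> ` L) S M R" "\<forall>a\<in>h ` L0. g (f a) = a"
      "strong (g ` \<phi> ` L) M R"
    using extension[OF A inC f_emb f_strong] by blast
  have "realizes (\<lambda>A. strong A M R) (orderings R) L0 L E h (g \<circ> \<phi>)"
    unfolding realizes_def
  proof (intro conjI ballI impI)
    show "inj_on (g \<circ> \<phi>) L" using g(1) \<phi> by (auto simp: embedding_def intro: comp_inj_on)
    show "(g \<circ> \<phi>) x = h x" if "x \<in> L0" for x using bspec[OF g(2), of "h x"] f_h[OF that] that by simp
    show "strong ((g \<circ> \<phi>) ` L) M R" using g(3) by (simp add: image_comp)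
    fix T assume T: "T \<in> triples L" "\<not> T \<subseteq> L0"
    have TL: "T \<subseteq> L" using T by (simp add: triples_def)
    have "orderings R (g ` \<phi> ` T) = u T"
      unfolding u_def
      using orderings_embedding[OF g(1) image_mono[OF TL]] orderings_embedding[OF emb TL] by simp
    then show "orderings R ((g \<circ> \<phi>) ` T) = of_bool (T \<in> E)"
      using u_new[OF T(2)] by (simp add: image_comp)
  qed
  then show ?thesis by (intro exI[of _ "g \<circ> \<phi>"])
qed

abbreviation sym_weight :: "('a \<times> 'a \<times> 'a) set \<Rightarrow> 'a set \<Rightarrow> nat" where
  "sym_weight R T \<equiv> min 1 (orderings R T)"

lemma d0_sym_eq_predim:
  assumes "finite X"
  shows "d0_sym (symmetrization R) X = predim (sym_weight R) X"
proof -
  have "(\<exists>a b c. T = {a, b, c} \<and> (a, b, c) \<in> symmetrization R) \<longleftrightarrow> 0 < orderings R T"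
    if "T \<in> triples X" for T
  proof -
    have "finite T" using that by (auto simp: triples_def card_ge_0_finite)
    then have "finite {t \<in> R. tset t = T}" by (rule finite_orderings)
    then have "0 < orderings R T \<longleftrightarrow> (\<exists>t\<in>R. tset t = T)"
      unfolding orderings_def card_gt_0_iff by blast
    also have "\<dots> \<longleftrightarrow> (\<exists>a b c. T = {a, b, c} \<and> (a, b, c) \<in> R)"
      unfolding Bex_def split_paired_Ex tset.simps by metis
    also have "\<dots> \<longleftrightarrow> (\<exists>a b c. T = {a, b, c} \<and> (a, b, c) \<in> symmetrization R)"
      unfolding symmetrization_def by (auto simp: insert_commute)
    finally show ?thesis by simp
  qed
  then have "triple_sets (symmetrization R) X = {T \<in> triples X. 0 < orderings R T}"
    by (auto simp: triple_sets_def triples_def)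
  also have "card \<dots> = (\<Sum>T\<in>triples X. if 0 < orderings R T then 1 else 0)"
    using assms by (simp add: sum.If_cases Int_def)
  also have "\<dots> = mass (sym_weight R) X"
    unfolding mass_def by (intro sum.cong) auto
  finally show ?thesis by (simp add: d0_sym_def predim_def)
qed

lemma generic_hull:
  assumes M: "hrushovski_generic M R" and X: "finite X" "X \<subseteq> M"
  shows "\<exists>B. strong B M R \<and> X \<subseteq> B"
proof -
  let ?P = "\<lambda>B. finite B \<and> X \<subseteq> B \<and> B \<subseteq> M"
  have pos: "0 \<le> d0 R B" if "?P B" for B
  proof -
    have "in_class_C B (induced R B)" using M that by (simp add: hrushovski_generic_def)
    then have "d0 (induced R B) {} \<le> d0 (induced R B) B" by (auto simp: in_class_C_def strong_def)
    then show ?thesis by (simp add: d0_def induced_def)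
  qed
  obtain B where B: "?P B" and min: "\<And>C. ?P C \<Longrightarrow> nat (d0 R B) \<le> nat (d0 R C)"
    using ex_has_least_nat[of ?P X "\<lambda>B. nat (d0 R B)"] X by auto
  have "d0 R B \<le> d0 R C" if "finite C" "B \<subseteq> C" "C \<subseteq> M" for C
  proof -
    have C: "?P C" using that B by auto
    then show ?thesis using min[OF C] pos[OF C] pos[OF B] by simp
  qed
  then show ?thesis using B by (intro exI[of _ B]) (simp add: strong_def)
qed

lemma generic_empty:
  assumes "hrushovski_generic M R"
  shows "strong {} M R"
  unfolding strong_def
proof (intro conjI allI impI)
  fix B assume "finite B \<and> {} \<subseteq> B \<and> B \<subseteq> M"
  then have "in_class_C B (induced R B)" using assms by (simp add: hrushovski_generic_def)
  then have "d0 (induced R B) {} \<le> d0 (induced R B) B" by (auto simp: in_class_C_def strong_def)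
  then show "d0 R {} \<le> d0 R B" by (simp add: d0_def induced_def)
qed simp_all

lemma rich_generic:
  assumes M: "hrushovski_generic (M :: 'a set) R"
  shows "rich_structure M (\<lambda>A. strong A M R) (orderings R)"
proof
  have irr: "irredundant R" using M by (simp add: hrushovski_generic_def is_structure_iff)
  show "predim (orderings R) A \<le> predim (orderings R) B"
    if "strong A M R" "finite B" "A \<subseteq> B" "B \<subseteq> M" for A B
    using that d0_eq_predim[OF irr, of A] d0_eq_predim[OF irr, of B] by (auto simp: strong_def)
  show "strong A M R \<Longrightarrow> finite A" "strong A M R \<Longrightarrow> A \<subseteq> M" for A
    by (simp_all add: strong_def)
qed (rule generic_empty[OF M] generic_hull[OF M] generic_extend[OF M]; assumption)+

text \<open>Truncating weights at \<open>1\<close> does not raise the mass of the triples not inside \<open>A\<close>, so strongness for \<open>R\<close>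
gives the inequality of strongness for the truncated weight; edges of weight \<open>0\<close> or \<open>1\<close> are unchanged.\<close>

lemma rich_symmetrization:
  assumes M: "hrushovski_generic (M :: 'a set) R"
  shows "rich_structure M (\<lambda>A. strong A M R) (sym_weight R)"
proof -
  interpret rich_structure M "\<lambda>A. strong A M R" "orderings R" by (rule rich_generic[OF M])
  show ?thesis
  proof
    fix A B assume A: "strong A M R" and B: "finite B" "A \<subseteq> B" "B \<subseteq> M"
    have "new_mass A (sym_weight R) B \<le> new_mass A (orderings R) B"
      unfolding new_mass_def by (intro sum_mono) auto
    then show "predim (sym_weight R) A \<le> predim (sym_weight R) B"
      using St_le[OF A B] mass_split[OF B(1), of "orderings R" A]
        mass_split[OF B(1), of "sym_weight R" A] B(2)
      by (simp add: predim_def Int_absorb1)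
  next
    fix L L0 :: "('a \<times> nat) set" and E h
    assume "finite L" "L0 \<subseteq> L" "inj_on h L0" "strong (h ` L0) M R" "admissible L0 L E"
    then obtain g where "realizes (\<lambda>A. strong A M R) (orderings R) L0 L E h g"
      using St_extend[of L L0 h E] by auto
    then have "realizes (\<lambda>A. strong A M R) (sym_weight R) L0 L E h g"
      by (simp add: realizes_def)
    then show "\<exists>g. realizes (\<lambda>A. strong A M R) (sym_weight R) L0 L E h g"
      by (intro exI[of _ g])
  qed (fact St_finite St_subset St_empty St_hull)+
qed

lemma dimension_cong:
  assumes "\<And>B. finite B \<Longrightarrow> B \<subseteq> M \<Longrightarrow> \<delta> B = \<delta>' B"
  shows "dimension \<delta> M = dimension \<delta>' M"
proof
  fix X
  have "(\<exists>B. finite B \<and> X \<subseteq> B \<and> B \<subseteq> M \<and> k = \<delta> B) \<longleftrightarrow>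
      (\<exists>B. finite B \<and> X \<subseteq> B \<and> B \<subseteq> M \<and> k = \<delta>' B)" for k
    using assms by metis
  then show "dimension \<delta> M X = dimension \<delta>' M X" unfolding dimension_def by simp
qed

theorem proposition8p15:
  fixes M :: "'a set" and R :: "('a \<times> 'a \<times> 'a) set"
  assumes "hrushovski_generic M R"
  shows "geometry_isomorphic (geometry M R) (geometry_sym M (symmetrization R))"
proof -
  have irr: "irredundant R" and M: "countable M"
    using assms by (simp_all add: hrushovski_generic_def is_structure_iff)
  have dim: "dimension (d0 R) M = dimension (predim (orderings R)) M"
    by (rule dimension_cong) (rule d0_eq_predim[OF irr])
  have dim_sym: "dimension (d0_sym (symmetrization R)) M = dimension (predim (sym_weight R)) M"
    by (rule dimension_cong) (rule d0_sym_eq_predim)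
  obtain F where F: "bij_betw F M M"
    and dm: "\<And>X. finite X \<Longrightarrow> X \<subseteq> M \<Longrightarrow>
      dimension (predim (sym_weight R)) M (F ` X) = dimension (predim (orderings R)) M X"
    using rich_structures_dimension_iso[OF rich_generic[OF assms] rich_symmetrization[OF assms] M M]
    by auto
  show ?thesis
    unfolding geometry_def geometry_sym_def dim dim_sym
  proof (rule geometry_isomorphicI[OF F])
    fix X assume X: "X \<subseteq> M"
    show "dim_closure (dimension (predim (orderings R)) M) M X \<subseteq> M"
      by (auto simp: dim_closure_def)
    show "dim_closure (dimension (predim (sym_weight R)) M) M (F ` X)
        = F ` dim_closure (dimension (predim (orderings R)) M) M X"
      using F dm X by (rule dim_closure_iso)
  qed
qed

end
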